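(* Let $k\geq 1$ be an integer and let $\Gamma$ be a finite, connected, vertex transitive graph without multiple edges or loops, with at least two vertices, whose diameter $D$ satisfies $D\leq 2k+1$. Let $\lambda_1$ be the first (i.e. smallest) non-zero eigenvalue of the normalized Laplacian $\mathcal{L}$ of $\Gamma$. Then $$\lambda_1\ \geq\ \frac{1}{D^{2}\,\mathrm{ind}_k(\Gamma)}.$$
   Context: $\Gamma$ is an undirected graph with vertex set $V=\{1,\dots,n\}$ and adjacency matrix $\epsilon=(\epsilon_{ij})$; $i\sim j$ means $\epsilon_{ij}=1$; $d_i$ is the degree of $i$; the volume is $\mathcal{V}=\sum_{i\in V}d_i$. The diameter $D$ is the maximum over pairs of vertices of the number of edges in a shortest path between them. $\Gamma$ is vertex transitive if its (classical) automorphism group acts transitively on $V$. The normalized Laplacian is the $n\times n$ matrix with $\mathcal{L}(i,i)=1$ if $d_i\neq 0$, $\mathcal{L}(i,j)=-1/\sqrt{d_id_j}$ if $i\sim j$, and $0$ otherwise; its eigenvalues are non-negative. A path of length $\alpha$ is a tuple $(i_1,\dots,i_{\alpha+1})$ of vertices with $\epsilon_{i_ti_{t+1}}=1$ for $1\le t\le\alpha$ (repetitions allowed). Edges are regarded as paths of length $1$, i.e. ordered pairs $(i,j)$ with $\epsilon_{ij}=1$. $C(\mathrm{Aut}^+(\Gamma))$ is the universal unital $C^*$-algebra generated by self-adjoint elements $q_{ij}$ ($1\le i,j\le n$) such that $\sum_j q_{ij}=1=\sum_j q_{ji}$ for all $i$, $q_{ij}q_{il}=\delta_{jl}q_{ij}$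 and $q_{ji}q_{li}=\delta_{jl}q_{ji}$ for all $i,j,l$, and $q\epsilon=\epsilon q$ where $q=(q_{ij})$. For $k\geq1$, $C(\mathbb{G}_k^+(\Gamma))$ is the universal $C^*$-algebra generated by elements $q_{ij}$ satisfying these relations together with $$q_{i_1j_1}q_{i_2j_2}\cdots q_{i_\beta j_\beta}=q_{i_\beta j_\beta}\cdots q_{i_2j_2}q_{i_1j_1}$$ for all $\beta\le k+1$ and all paths $(i_1,\dots,i_\beta)$, $(j_1,\dots,j_\beta)$. Two paths $(i_1,\dots,i_\gamma)$ and $(j_1,\dots,j_\gamma)$ are $k$-equivalent, written $(i_1,\dots,i_\gamma)\sim^k(j_1,\dots,j_\gamma)$, if $q_{i_1j_1}\cdots q_{i_\gamma j_\gamma}\neq 0$ in $C(\mathbb{G}_k^+(\Gamma))$. This is an equivalence relation on paths of length at most $2k+1$. Let $E_1^k,\dots,E_m^k$ be the $\sim^k$-equivalence classes of edges, $r_k=\min_i|E_i^k|$, and $\mathrm{ind}_k(\Gamma)=\mathcal{V}/r_k$. *)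

theory Defs
  imports
    "HOL-Analysis.Analysis"
    "HOL-Library.Poly_Mapping"
    "HOL-Algebra.Module"
begin

section \<open>Universal unital C*-algebras\<close>

subsection \<open>The free unital *-algebra\<close>

text \<open>
  A letter \<open>(g, False)\<close> is the generator \<open>g\<close>, a letter \<open>(g, True)\<close> is its adjoint. Words are wrapped
  in a datatype of their own so that concatenation can be the (noncommutative) addition of a
  \<^class>\<open>monoid_add\<close>; the convolution product on \<open>_ \<Rightarrow>\<^sub>0 complex\<close> is then the product of
  noncommutative *-polynomials.
\<close>

datatype 'g star_word = Word (letters: "('g \<times> bool) list")

instantiation star_word :: (type) monoid_add
begin

definition zero_star_word :: "'a star_word" where
  "0 = Word []"

definition plus_star_word :: "'a star_word \<Rightarrow> 'a star_word \<Rightarrow> 'a star_word" where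
  "v + w = Word (letters v @ letters w)"

instance
  by standard (simp_all add: zero_star_word_def plus_star_word_def)

end

type_synonym 'g free_star_alg = "'g star_word \<Rightarrow>\<^sub>0 complex"

definition gen :: "'g \<Rightarrow> 'g free_star_alg" where
  "gen g = Poly_Mapping.single (Word [(g, False)]) 1"

definition free_scale :: "complex \<Rightarrow> 'g free_star_alg \<Rightarrow> 'g free_star_alg" where
  "free_scale c x = Poly_Mapping.single 0 c * x"

definition word_star :: "'g star_word \<Rightarrow> 'g star_word" where
  "word_star w = Word (rev (map (\<lambda>(g, b). (g, \<not> b)) (letters w)))"

definition free_star :: "'g free_star_alg \<Rightarrow> 'g free_star_alg" where
  "free_star x =
     (\<Sum>w\<in>Poly_Mapping.keys x. Poly_Mapping.single (word_star w) (cnj (Poly_Mapping.lookup x w)))"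

subsection \<open>The universal C*-seminorm and its completion\<close>

definition cstar_seminorm :: "('g free_star_alg \<Rightarrow> real) \<Rightarrow> bool" where
  "cstar_seminorm p \<longleftrightarrow>
     (\<forall>x. 0 \<le> p x) \<and>
     (\<forall>x y. p (x + y) \<le> p x + p y) \<and>
     (\<forall>c x. p (free_scale c x) = cmod c * p x) \<and>
     (\<forall>x y. p (x * y) \<le> p x * p y) \<and>
     (\<forall>x. p (free_star x * x) = (p x)\<^sup>2)"

text \<open>
  A relation is an element of the free *-algebra that is required to vanish. The kernel of a
  C*-seminorm is a *-ideal, so the seminorms below are exactly those of the quotient of the free
  *-algebra by the *-ideal generated by \<open>R\<close>. As always, the universal C*-algebra exists only if the
  supremum is finite for every \<open>x\<close>; this holds for the relations used below, which force
  \<open>p (gen g) \<le> 1\<close>.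
\<close>

definition univ_norm :: "'g free_star_alg set \<Rightarrow> 'g free_star_alg \<Rightarrow> real" where
  "univ_norm R x = (SUP p \<in> {p. cstar_seminorm p \<and> (\<forall>r\<in>R. p r = 0)}. p x)"

definition univ_Cauchy :: "'g free_star_alg set \<Rightarrow> (nat \<Rightarrow> 'g free_star_alg) set" where
  "univ_Cauchy R = {X. \<forall>e>0. \<exists>N. \<forall>m\<ge>N. \<forall>n\<ge>N. univ_norm R (X m - X n) < e}"

definition univ_rel :: "'g free_star_alg set \<Rightarrow> (nat \<Rightarrow> 'g free_star_alg) rel" where
  "univ_rel R = {(X, Y). X \<in> univ_Cauchy R \<and> Y \<in> univ_Cauchy R \<and>
     (\<lambda>n. univ_norm R (X n - Y n)) \<longlonglongrightarrow> 0}"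

definition univ_class :: "'g free_star_alg set \<Rightarrow> (nat \<Rightarrow> 'g free_star_alg)
    \<Rightarrow> (nat \<Rightarrow> 'g free_star_alg) set" where
  "univ_class R X = univ_rel R `` {X}"

record 'a star_algebra = "(complex, 'a) module" +
  star :: "'a \<Rightarrow> 'a"
  alg_norm :: "'a \<Rightarrow> real"

text \<open>
  The separated completion of the free *-algebra with respect to the universal C*-seminorm:
  equivalence classes of Cauchy sequences, with the operations induced by representatives.
\<close>

definition universal_cstar ::
    "'g free_star_alg set \<Rightarrow> (nat \<Rightarrow> 'g free_star_alg) set star_algebra" where
  "universal_cstar R =
     \<lparr>carrier = univ_Cauchy R // univ_rel R,
      mult = (\<lambda>A B. \<Union>X\<in>A. \<Union>Y\<in>B. univ_class R (\<lambda>n. X n * Y n)),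
      one = univ_class R (\<lambda>_. 1),
      zero = univ_class R (\<lambda>_. 0),
      add = (\<lambda>A B. \<Union>X\<in>A. \<Union>Y\<in>B. univ_class R (\<lambda>n. X n + Y n)),
      smult = (\<lambda>c A. \<Union>X\<in>A. univ_class R (\<lambda>n. free_scale c (X n))),
      star = (\<lambda>A. \<Union>X\<in>A. univ_class R (\<lambda>n. free_star (X n))),
      alg_norm = (\<lambda>A. THE r. \<forall>X\<in>A. (\<lambda>n. univ_norm R (X n)) \<longlonglongrightarrow> r)\<rparr>"

definition univ_gen ::
    "'g free_star_alg set \<Rightarrow> 'g \<Rightarrow> (nat \<Rightarrow> 'g free_star_alg) set" where
  "univ_gen R g = univ_class R (\<lambda>_. gen g)"


section \<open>Finite graphs\<close>

text \<open>
  The vertex set is a finite type \<open>'v\<close>, and a graph is given by its adjacency relation.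
\<close>

definition simple_graph :: "('v \<Rightarrow> 'v \<Rightarrow> bool) \<Rightarrow> bool" where
  "simple_graph E \<longleftrightarrow> symp E \<and> irreflp E"

text \<open>A path is its nonempty list of vertices; its length is one less than that of the list.\<close>

definition graph_path :: "('v \<Rightarrow> 'v \<Rightarrow> bool) \<Rightarrow> 'v list \<Rightarrow> bool" where
  "graph_path E p \<longleftrightarrow> p \<noteq> [] \<and> successively E p"

definition path_between :: "('v \<Rightarrow> 'v \<Rightarrow> bool) \<Rightarrow> 'v \<Rightarrow> 'v \<Rightarrow> nat \<Rightarrow> bool" where
  "path_between E i j l \<longleftrightarrow>
     (\<exists>p. graph_path E p \<and> hd p = i \<and> last p = j \<and> length p = l + 1)"

definition connected_graph :: "('v \<Rightarrow> 'v \<Rightarrow> bool) \<Rightarrow> bool" where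
  "connected_graph E \<longleftrightarrow> (\<forall>i j. \<exists>l. path_between E i j l)"

definition graph_dist :: "('v \<Rightarrow> 'v \<Rightarrow> bool) \<Rightarrow> 'v \<Rightarrow> 'v \<Rightarrow> nat" where
  "graph_dist E i j = (LEAST l. path_between E i j l)"

definition diam :: "('v::finite \<Rightarrow> 'v \<Rightarrow> bool) \<Rightarrow> nat" where
  "diam E = Max {graph_dist E i j | i j. True}"

definition graph_automorphism :: "('v \<Rightarrow> 'v \<Rightarrow> bool) \<Rightarrow> ('v \<Rightarrow> 'v) \<Rightarrow> bool" where
  "graph_automorphism E \<sigma> \<longleftrightarrow> bij \<sigma> \<and> (\<forall>i j. E (\<sigma> i) (\<sigma> j) \<longleftrightarrow> E i j)"

definition vertex_transitive :: "('v \<Rightarrow> 'v \<Rightarrow> bool) \<Rightarrow> bool" where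
  "vertex_transitive E \<longleftrightarrow> (\<forall>i j. \<exists>\<sigma>. graph_automorphism E \<sigma> \<and> \<sigma> i = j)"

definition deg :: "('v::finite \<Rightarrow> 'v \<Rightarrow> bool) \<Rightarrow> 'v \<Rightarrow> nat" where
  "deg E i = card {j. E i j}"

definition volume :: "('v::finite \<Rightarrow> 'v \<Rightarrow> bool) \<Rightarrow> nat" where
  "volume E = (\<Sum>i\<in>UNIV. deg E i)"

definition normalized_Laplacian :: "('v::finite \<Rightarrow> 'v \<Rightarrow> bool) \<Rightarrow> real ^ 'v ^ 'v" where
  "normalized_Laplacian E =
     (\<chi> i j. if i = j \<and> deg E i \<noteq> 0 then 1
             else if E i j then - 1 / sqrt (real (deg E i) * real (deg E j))
             else 0)"

definition real_eigenvalue :: "real ^ 'n ^ 'n \<Rightarrow> real \<Rightarrow> bool" where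
  "real_eigenvalue A \<mu> \<longleftrightarrow> (\<exists>x. x \<noteq> 0 \<and> A *v x = \<mu> *\<^sub>R x)"

definition lambda1 :: "('v::finite \<Rightarrow> 'v \<Rightarrow> bool) \<Rightarrow> real" where
  "lambda1 E = Min {\<mu>. real_eigenvalue (normalized_Laplacian E) \<mu> \<and> \<mu> \<noteq> 0}"


section \<open>Quantum automorphism groups\<close>

abbreviation qgen :: "'v \<Rightarrow> 'v \<Rightarrow> ('v \<times> 'v) free_star_alg" where
  "qgen i j \<equiv> gen (i, j)"

definition aut_plus_relations ::
    "('v::finite \<Rightarrow> 'v \<Rightarrow> bool) \<Rightarrow> ('v \<times> 'v) free_star_alg set" where
  "aut_plus_relations E =
     {free_star (qgen i j) - qgen i j | i j. True} \<union>
     {(\<Sum>j\<in>UNIV. qgen i j) - 1 | i. True} \<union>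
     {(\<Sum>j\<in>UNIV. qgen j i) - 1 | i. True} \<union>
     {qgen i j * qgen i l - of_bool (j = l) * qgen i j | i j l. True} \<union>
     {qgen j i * qgen l i - of_bool (j = l) * qgen j i | i j l. True} \<union>
     {(\<Sum>l\<in>UNIV. qgen i l * of_bool (E l j)) - (\<Sum>l\<in>UNIV. of_bool (E i l) * qgen l j)
       | i j. True}"

definition path_monomial :: "'v list \<Rightarrow> 'v list \<Rightarrow> ('v \<times> 'v) free_star_alg" where
  "path_monomial is js = prod_list (map2 qgen is js)"

definition Gk_relations ::
    "('v::finite \<Rightarrow> 'v \<Rightarrow> bool) \<Rightarrow> nat \<Rightarrow> ('v \<times> 'v) free_star_alg set" where
  "Gk_relations E k = aut_plus_relations E \<union>
     {path_monomial is js - path_monomial (rev is) (rev js) | is js.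
        graph_path E is \<and> graph_path E js \<and> length is = length js \<and> length is \<le> k + 1}"

definition C_Gk :: "('v::finite \<Rightarrow> 'v \<Rightarrow> bool) \<Rightarrow> nat
    \<Rightarrow> (nat \<Rightarrow> ('v \<times> 'v) free_star_alg) set star_algebra" where
  "C_Gk E k = universal_cstar (Gk_relations E k)"

definition q_Gk :: "('v::finite \<Rightarrow> 'v \<Rightarrow> bool) \<Rightarrow> nat \<Rightarrow> 'v \<Rightarrow> 'v
    \<Rightarrow> (nat \<Rightarrow> ('v \<times> 'v) free_star_alg) set" where
  "q_Gk E k i j = univ_gen (Gk_relations E k) (i, j)"

definition k_equivalent ::
    "('v::finite \<Rightarrow> 'v \<Rightarrow> bool) \<Rightarrow> nat \<Rightarrow> 'v list \<Rightarrow> 'v list \<Rightarrow> bool" where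
  "k_equivalent E k is js \<longleftrightarrow>
     graph_path E is \<and> graph_path E js \<and> length is = length js \<and>
     foldr (mult (C_Gk E k)) (map2 (q_Gk E k) is js) \<one>\<^bsub>C_Gk E k\<^esub> \<noteq> \<zero>\<^bsub>C_Gk E k\<^esub>"

text \<open>Edges are paths of length one, i.e. ordered pairs of adjacent vertices.\<close>

definition edge_classes ::
    "('v::finite \<Rightarrow> 'v \<Rightarrow> bool) \<Rightarrow> nat \<Rightarrow> 'v list set set" where
  "edge_classes E k =
     {e. graph_path E e \<and> length e = 2} // {(e, f). length e = 2 \<and> k_equivalent E k e f}"

definition min_class_size :: "('v::finite \<Rightarrow> 'v \<Rightarrow> bool) \<Rightarrow> nat \<Rightarrow> nat" where
  "min_class_size E k = Min (card ` edge_classes E k)"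

definition ind :: "('v::finite \<Rightarrow> 'v \<Rightarrow> bool) \<Rightarrow> nat \<Rightarrow> real" where
  "ind E k = real (volume E) / real (min_class_size E k)"

end

theory Submission
  imports Defs
begin

text \<open>
  Put on each pair \<open>(x, y)\<close> the uniform probability distribution over the shortest paths from \<open>x\<close>
  to \<open>y\<close>, and let the load of an edge be the expected number of times it is traversed, summed over
  all pairs. Telescoping along shortest paths and the Cauchy-Schwarz inequality bound
  \<open>\<Sum> (f x - f y)\<^sup>2\<close>, taken over all pairs, by \<open>D\<close> times the energy of \<open>f\<close> weighted by the load,
  and the total load is at most \<open>D * n\<^sup>2\<close>. If the load is constant on edge classes, it is therefore
  at most \<open>D * n\<^sup>2 / r\<close> everywhere; take for \<open>f\<close> an eigenfunction of \<open>\<lambda>\<^sub>1\<close>.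

  The load is constant on edge classes by double counting in the quantum automorphism group. Let
  \<open>Q xs ys\<close> be the product of the generators \<open>q (xs ! i) (ys ! i)\<close>. Summing it over all lists \<open>ys\<close>
  with two prescribed entries leaves the product of two generators, because the rows sum to one, and
  likewise for \<open>xs\<close> and columns. So if \<open>Q xs ys \<noteq> 0\<close> forces \<open>w xs = w ys\<close> and \<open>q a c * q b d \<noteq> 0\<close>,
  then \<open>w\<close> has the same sum over the lists through \<open>(a, b)\<close> as over those through \<open>(c, d)\<close>. Taking
  for \<open>w\<close> the indicator of paths with prescribed end points shows that numbers of walks, hence
  distances, are preserved; with the reversal relations this makes the shortest path weight an
  admissible \<open>w\<close>. No equivalence
  of paths beyond \<open>Q \<noteq> 0\<close> enters, which avoids the comultiplication.
\<close>

section \<open>C*-seminorms and the universal C*-algebra\<close>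

lemma letter_adjoint: "Poly_Mapping.single (Word [(g, True)]) (1::complex) = free_star (gen g)"
  by (simp add: free_star_def gen_def word_star_def)

section \<open>Calculus modulo the kernel of one C*-seminorm\<close>

locale cstar_seminorm_on =
  fixes R :: "'g free_star_alg set" and p :: "'g free_star_alg \<Rightarrow> real"
  assumes cstar: "cstar_seminorm p" and kills: "\<And>r. r \<in> R \<Longrightarrow> p r = 0"
begin

lemma nonneg: "0 \<le> p x"
  and triangle: "p (x + y) \<le> p x + p y"
  and scale: "p (free_scale c x) = cmod c * p x"
  and submult: "p (x * y) \<le> p x * p y"
  and cstar_identity: "p (free_star x * x) = (p x)\<^sup>2"
  using cstar unfolding cstar_seminorm_def by blast+

lemma zero: "p 0 = 0"
  using scale[of 0 0] by (simp add: free_scale_def)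

lemma minus: "p (- x) = p x"
  using scale[of "-1" x] by (simp add: free_scale_def single_uminus)

lemma minus_commute: "p (x - y) = p (y - x)"
  using minus[of "x - y"] by simp

text \<open>Equality in the quotient by the kernel of \<open>p\<close>. The rules below make it a
  congruence, so the relations can be applied while all terms stay in the free algebra.\<close>

definition eqv :: "'g free_star_alg \<Rightarrow> 'g free_star_alg \<Rightarrow> bool" (infix "\<doteq>" 50)
  where "x \<doteq> y \<longleftrightarrow> p (x - y) = 0"

lemma eqv_refl [simp, intro]: "x \<doteq> x"
  by (simp add: eqv_def zero)

lemma eqv_sym: "x \<doteq> y \<Longrightarrow> y \<doteq> x"
  by (simp add: eqv_def minus_commute)

lemma eqv_trans [trans]: "x \<doteq> y \<Longrightarrow> y \<doteq> z \<Longrightarrow> x \<doteq> z"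
  using triangle[of "x - y" "y - z"] nonneg[of "x - z"] by (simp add: eqv_def)

lemma eqv_zero_iff: "x \<doteq> 0 \<longleftrightarrow> p x = 0"
  by (simp add: eqv_def)

lemma eqv_norm: assumes "x \<doteq> y" shows "p x = p y"
proof -
  have "p x \<le> p (x - y) + p y" "p y \<le> p (y - x) + p x"
    using triangle[of "x - y" y] triangle[of "y - x" x] by simp_all
  then show ?thesis using assms minus_commute[of x y] by (simp add: eqv_def)
qed

lemma eqv_add: assumes "x \<doteq> x'" "y \<doteq> y'" shows "x + y \<doteq> x' + y'"
proof -
  have "p ((x + y) - (x' + y')) \<le> p (x - x') + p (y - y')"
    using triangle[of "x - x'" "y - y'"] by (simp add: algebra_simps)
  then show ?thesis using assms nonneg[of "(x + y) - (x' + y')"] by (simp add: eqv_def)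
qed

lemma null_mult_left: "p y = 0 \<Longrightarrow> p (x * y) = 0"
  using submult[of x y] nonneg[of "x * y"] by simp

lemma null_mult_right: "p x = 0 \<Longrightarrow> p (x * y) = 0"
  using submult[of x y] nonneg[of "x * y"] by simp

lemma eqv_mult: assumes "x \<doteq> x'" "y \<doteq> y'" shows "x * y \<doteq> x' * y'"
proof -
  have "x * y \<doteq> x' * y"
    using assms(1) null_mult_right[of "x - x'" y] by (simp add: eqv_def algebra_simps)
  also have "x' * y \<doteq> x' * y'"
    using assms(2) null_mult_left[of "y - y'" x'] by (simp add: eqv_def algebra_simps)
  finally show ?thesis .
qed

lemma eqv_sum: "(\<And>i. i \<in> A \<Longrightarrow> f i \<doteq> g i) \<Longrightarrow> sum f A \<doteq> sum g A"
  by (induction A rule: infinite_finite_induct) (auto intro: eqv_add)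

lemma eqv_prod_list: "list_all2 (\<doteq>) xs ys \<Longrightarrow> prod_list xs \<doteq> prod_list ys"
  by (induction rule: list_all2_induct) (auto intro: eqv_mult)

lemma eqv_kills: "x - y \<in> R \<Longrightarrow> x \<doteq> y"
  by (simp add: eqv_def kills)

lemma sum_le: "p (sum f A) \<le> (\<Sum>i\<in>A. p (f i))"
proof (induction A rule: infinite_finite_induct)
  case (insert a A)
  then show ?case using triangle[of "f a" "sum f A"] by simp
qed (auto simp: zero)

text \<open>The unit is self-adjoint, so the C*-identity makes \<open>p 1\<close> equal to its own
  square, hence 0 or 1. The value 0 occurs for the zero seminorm.\<close>

lemma norm_one_le: "p 1 \<le> 1"
proof -
  have "free_star 1 = (1 :: 'g free_star_alg)"
    by (simp add: free_star_def word_star_def zero_star_word_def flip: single_one)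
  then have "p 1 = (p 1)\<^sup>2" using cstar_identity[of 1] by simp
  then show ?thesis by (metis le_cases nonneg power2_eq_square mult_cancel_right1 order_refl zero_le_one)
qed

lemma norm_projection_le:
  assumes "free_star x \<doteq> x" "x * x \<doteq> x" shows "p x \<le> 1"
proof -
  have "free_star x * x \<doteq> x * x" using assms(1) by (intro eqv_mult) auto
  also have "x * x \<doteq> x" by fact
  finally have "p x = (p x)\<^sup>2" using cstar_identity[of x] eqv_norm by simp
  then show ?thesis by (metis le_cases nonneg power2_eq_square mult_cancel_right1 order_refl zero_le_one)
qed

text \<open>The bound does not depend on \<open>p\<close>, which makes the supremum in
  \<open>univ_norm\<close> finite. Modulo \<open>p\<close> every generator is a projection, so
  letters and then words have seminorm at most 1.\<close>

lemma norm_le_sum_coeffs: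
  assumes "\<And>g. free_star (gen g) \<doteq> gen g" "\<And>g. gen g * gen g \<doteq> gen g"
  shows "p x \<le> (\<Sum>w\<in>Poly_Mapping.keys x. cmod (Poly_Mapping.lookup x w))"
proof -
  have letter: "p (Poly_Mapping.single (Word [l]) 1) \<le> 1" for l
  proof (cases l)
    case (Pair g b)
    have "p (gen g) \<le> 1" by (rule norm_projection_le) (use assms in auto)
    moreover have "p (free_star (gen g)) = p (gen g)" using assms(1) by (rule eqv_norm)
    ultimately show ?thesis
      using Pair letter_adjoint[of g] by (cases b) (simp_all add: gen_def)
  qed
  have word: "p (Poly_Mapping.single (Word ls) 1) \<le> 1" for ls
  proof (induction ls)
    case Nil
    then show ?case using norm_one_le by (simp add: zero_star_word_def flip: single_one)
  next
    case (Cons l ls)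
    have "Poly_Mapping.single (Word (l # ls)) (1::complex)
        = Poly_Mapping.single (Word [l]) 1 * Poly_Mapping.single (Word ls) 1"
      by (simp add: mult_single plus_star_word_def)
    then have "p (Poly_Mapping.single (Word (l # ls)) 1) \<le> 
        p (Poly_Mapping.single (Word [l]) 1) * p (Poly_Mapping.single (Word ls) 1)"
      using submult by metis
    also have "\<dots> \<le> 1 * 1" using letter Cons.IH nonneg by (intro mult_mono) auto
    finally show ?case by simp
  qed
  have "p (Poly_Mapping.single w c) \<le> cmod c" for w c
  proof -
    have "p (Poly_Mapping.single w c) = cmod c * p (Poly_Mapping.single w 1)"
      using scale[of c "Poly_Mapping.single w 1"] by (simp add: free_scale_def mult_single)
    then show ?thesis using word[of "letters w"] by (simp add: mult_left_le)
  qed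
  moreover have "x = (\<Sum>w\<in>Poly_Mapping.keys x. Poly_Mapping.single w (Poly_Mapping.lookup x w))"
    by (rule poly_mapping_eqI)
       (simp add: lookup_sum lookup_single when_def sum.delta in_keys_iff)
  ultimately show ?thesis
    using sum_le[of "\<lambda>w. Poly_Mapping.single w (Poly_Mapping.lookup x w)" "Poly_Mapping.keys x"]
    by (metis (no_types, lifting) order_trans sum_mono)
qed

end

section \<open>The universal norm and products of constant classes\<close>

lemma cstar_seminorm_zero: "cstar_seminorm (\<lambda>_. 0)"
  by (simp add: cstar_seminorm_def)

lemma tendsto_sandwich_zero:
  assumes "f \<longlonglongrightarrow> (0::real)" "\<And>n. 0 \<le> g n" "\<And>n. g n \<le> f n"
  shows "g \<longlonglongrightarrow> 0"
  using tendsto_sandwich[OF _ _ tendsto_const assms(1), of g] assms(2,3) by simp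

locale bounded_relations =
  fixes R :: "'g free_star_alg set"
  assumes bounded: "bdd_above ((\<lambda>p. p x) ` {p. cstar_seminorm p \<and> (\<forall>r\<in>R. p r = 0)})"
begin

abbreviation "nrm \<equiv> univ_norm R"

lemma seminorm_le: "cstar_seminorm_on R p \<Longrightarrow> p x \<le> nrm x"
  unfolding univ_norm_def cstar_seminorm_on_def by (rule cSUP_upper[OF _ bounded]) auto

lemma univ_norm_le:
  assumes "\<And>p. cstar_seminorm_on R p \<Longrightarrow> p x \<le> c" shows "nrm x \<le> c"
  unfolding univ_norm_def
proof (rule cSUP_least)
  show "{p. cstar_seminorm p \<and> (\<forall>r\<in>R. p r = 0)} \<noteq> {}" using cstar_seminorm_zero by blast
qed (use assms in \<open>auto simp: cstar_seminorm_on_def\<close>)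

lemma zero_seminorm: "cstar_seminorm_on R (\<lambda>_. 0)"
  by (simp add: cstar_seminorm_on_def cstar_seminorm_zero)

lemma univ_norm_nonneg: "0 \<le> nrm x"
  using seminorm_le[OF zero_seminorm] .

lemma univ_norm_triangle: "nrm (x + y) \<le> nrm x + nrm y"
  by (rule univ_norm_le)
     (meson add_mono cstar_seminorm_on.triangle order_trans seminorm_le)

lemma univ_norm_mult: "nrm (x * y) \<le> nrm x * nrm y"
  by (rule univ_norm_le)
     (meson mult_mono cstar_seminorm_on.submult cstar_seminorm_on.nonneg order_trans seminorm_le univ_norm_nonneg)

lemma univ_norm_zero: "nrm 0 = 0"
  using univ_norm_le[of 0 0] univ_norm_nonneg[of 0] cstar_seminorm_on.zero by fastforce

lemma univ_norm_minus_commute: "nrm (x - y) = nrm (y - x)"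
  by (intro antisym univ_norm_le) (metis cstar_seminorm_on.minus_commute seminorm_le)+

lemma convergent_in_univ_Cauchy:
  assumes "(\<lambda>n. nrm (X n - x)) \<longlonglongrightarrow> 0" shows "X \<in> univ_Cauchy R"
  unfolding univ_Cauchy_def mem_Collect_eq
proof (intro allI impI)
  fix e :: real assume "e > 0"
  then have "\<forall>\<^sub>F n in sequentially. nrm (X n - x) < e / 2"
    using order_tendstoD(2)[OF assms, of "e/2"] by simp
  then obtain N where N: "\<And>n. n \<ge> N \<Longrightarrow> nrm (X n - x) < e / 2"
    unfolding eventually_sequentially by blast
  have "nrm (X m - X n) < e" if "m \<ge> N" "n \<ge> N" for m n
    using univ_norm_triangle[of "X m - x" "x - X n"] univ_norm_minus_commute[of "X n" x]
      N[OF that(1)] N[OF that(2)] by simp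
  then show "\<exists>N. \<forall>m\<ge>N. \<forall>n\<ge>N. nrm (X m - X n) < e" by blast
qed

lemma const_in_univ_Cauchy: "(\<lambda>_. x) \<in> univ_Cauchy R"
  by (simp add: univ_Cauchy_def univ_norm_zero)

lemma univ_class_const: "univ_class R (\<lambda>_. x) = {X. (\<lambda>n. nrm (X n - x)) \<longlonglongrightarrow> 0}"
  using convergent_in_univ_Cauchy[of _ x]
  by (auto simp: univ_class_def univ_rel_def const_in_univ_Cauchy univ_norm_minus_commute[of x])

text \<open>The operations of \<open>universal_cstar\<close> are unions over all representatives;
  this collapses such a union when the representatives converge to an element of the free
  algebra.\<close>

lemma univ_class_convergent:
  assumes "(\<lambda>n. nrm (X n - x)) \<longlonglongrightarrow> 0"
  shows "univ_class R X = univ_class R (\<lambda>_. x)"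
proof -
  have "(\<lambda>n. nrm (X n - Y n)) \<longlonglongrightarrow> 0 \<longleftrightarrow> (\<lambda>n. nrm (Y n - x)) \<longlonglongrightarrow> 0" for Y
  proof
    assume *: "(\<lambda>n. nrm (X n - Y n)) \<longlonglongrightarrow> 0"
    show "(\<lambda>n. nrm (Y n - x)) \<longlonglongrightarrow> 0"
    proof (rule tendsto_sandwich_zero)
      show "(\<lambda>n. nrm (X n - Y n) + nrm (X n - x)) \<longlonglongrightarrow> 0" using tendsto_add[OF * assms] by simp
      show "nrm (Y n - x) \<le> nrm (X n - Y n) + nrm (X n - x)" for n
        using univ_norm_triangle[of "Y n - X n" "X n - x"] univ_norm_minus_commute[of "Y n" "X n"] by simp
    qed (rule univ_norm_nonneg)
  next
    assume *: "(\<lambda>n. nrm (Y n - x)) \<longlonglongrightarrow> 0"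
    show "(\<lambda>n. nrm (X n - Y n)) \<longlonglongrightarrow> 0"
    proof (rule tendsto_sandwich_zero)
      show "(\<lambda>n. nrm (X n - x) + nrm (Y n - x)) \<longlonglongrightarrow> 0" using tendsto_add[OF assms *] by simp
      show "nrm (X n - Y n) \<le> nrm (X n - x) + nrm (Y n - x)" for n
        using univ_norm_triangle[of "X n - x" "x - Y n"] univ_norm_minus_commute[of "Y n" x] by simp
    qed (rule univ_norm_nonneg)
  qed
  moreover have "X \<in> univ_Cauchy R" using assms by (rule convergent_in_univ_Cauchy)
  ultimately have "univ_class R X = {Y. (\<lambda>n. nrm (Y n - x)) \<longlonglongrightarrow> 0}"
    using convergent_in_univ_Cauchy[of _ x]
    by (auto simp: univ_class_def univ_rel_def)
  then show ?thesis by (simp add: univ_class_const)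
qed

text \<open>Multiplication is continuous, so all representatives of the factors yield the same
  class. Generators are classes of constant sequences, so this case covers every path
  monomial.\<close>

lemma mult_univ_class_const:
  "mult (universal_cstar R) (univ_class R (\<lambda>_. x)) (univ_class R (\<lambda>_. y))
     = univ_class R (\<lambda>_. x * y)"
proof -
  have prod: "univ_class R (\<lambda>n. X n * Y n) = univ_class R (\<lambda>_. x * y)"
    if X: "(\<lambda>n. nrm (X n - x)) \<longlonglongrightarrow> 0" and Y: "(\<lambda>n. nrm (Y n - y)) \<longlonglongrightarrow> 0" for X Y
  proof (rule univ_class_convergent, rule tendsto_sandwich_zero)
    \<comment> \<open>Writing \<open>Y n\<close> as \<open>Y n - y + y\<close> bounds its norm by a
      convergent sequence.\<close>
    show "(\<lambda>n. nrm (X n - x) * (nrm (Y n - y) + nrm y) + nrm x * nrm (Y n - y)) \<longlonglongrightarrow> 0"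
      using X Y by (auto intro!: tendsto_eq_intros)
    fix n
    have "X n * Y n - x * y = (X n - x) * (Y n - y + y) + x * (Y n - y)"
      by (simp add: algebra_simps)
    then have "nrm (X n * Y n - x * y) \<le> nrm ((X n - x) * (Y n - y + y)) + nrm (x * (Y n - y))"
      using univ_norm_triangle by metis
    also have "\<dots> \<le> nrm (X n - x) * nrm (Y n - y + y) + nrm x * nrm (Y n - y)"
      by (intro add_mono univ_norm_mult)
    also have "\<dots> \<le> nrm (X n - x) * (nrm (Y n - y) + nrm y) + nrm x * nrm (Y n - y)"
      by (intro add_mono mult_left_mono univ_norm_triangle univ_norm_nonneg order_refl)
    finally show "nrm (X n * Y n - x * y)
        \<le> nrm (X n - x) * (nrm (Y n - y) + nrm y) + nrm x * nrm (Y n - y)" .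
  qed (rule univ_norm_nonneg)
  \<comment> \<open>Both classes are nonempty, so the union of a constant family over them is its
    value.\<close>
  have mem: "(\<lambda>_. x) \<in> univ_class R (\<lambda>_. x)" for x by (simp add: univ_class_const univ_norm_zero)
  have "mult (universal_cstar R) (univ_class R (\<lambda>_. x)) (univ_class R (\<lambda>_. y))
      = (\<Union>X\<in>univ_class R (\<lambda>_. x). \<Union>Y\<in>univ_class R (\<lambda>_. y). univ_class R (\<lambda>_. x * y))"
    unfolding universal_cstar_def partial_object.simps monoid.simps
    by (intro SUP_cong refl prod) (simp_all add: univ_class_const)
  also have "\<dots> = univ_class R (\<lambda>_. x * y)" using mem by blast
  finally show ?thesis .
qed

lemma foldr_mult_univ_class:
  "foldr (mult (universal_cstar R)) (map (\<lambda>x. univ_class R (\<lambda>_. x)) xs) \<one>\<^bsub>universal_cstar R\<^esub>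
     = univ_class R (\<lambda>_. prod_list xs)"
  by (induction xs) (simp_all add: mult_univ_class_const, simp add: universal_cstar_def)

text \<open>A nonzero supremum of seminorm values has a nonzero member. From here on a single
  seminorm can replace the completed algebra.\<close>

lemma univ_class_const_nonzero:
  assumes "univ_class R (\<lambda>_. x) \<noteq> \<zero>\<^bsub>universal_cstar R\<^esub>"
  obtains p where "cstar_seminorm_on R p" "p x \<noteq> 0"
proof -
  have "nrm x \<noteq> 0"
  proof
    assume "nrm x = 0"
    then have "univ_class R (\<lambda>_. x) = univ_class R (\<lambda>_. 0)"
      by (intro univ_class_convergent) simp
    with assms show False by (simp add: universal_cstar_def)
  qed
  then have "\<exists>p. cstar_seminorm_on R p \<and> p x \<noteq> 0"
    using univ_norm_le[of x 0] univ_norm_nonneg[of x] by force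
  then show ?thesis using that by blast
qed

end

section \<open>Sums over lists with two prescribed entries\<close>

lemma in_listset_iff:
  "xs \<in> listset As \<longleftrightarrow> length xs = length As \<and> (\<forall>i<length As. xs ! i \<in> As ! i)"
proof (induction As arbitrary: xs)
  case (Cons A As)
  then show ?case
    by (cases xs) (auto simp: set_Cons_def less_Suc_eq_0_disj)
qed auto

text \<open>Distributivity of a product over sums, with the order of the factors kept because
  generators do not commute.\<close>

lemma sum_listset_prod_list:
  fixes f :: "'a \<Rightarrow> 'b \<Rightarrow> 'c::semiring_1"
  assumes "length xs = length As"
  shows "(\<Sum>ys\<in>listset As. prod_list (map2 f xs ys))
       = prod_list (map2 (\<lambda>x A. \<Sum>y\<in>A. f x y) xs As)"
  using assms
proof (induction xs As rule: list_induct2)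
  case (Cons x xs A As)
  have "set_Cons A (listset As) = (\<lambda>(y, ys). y # ys) ` (A \<times> listset As)"
    by (auto simp: set_Cons_def)
  moreover have "inj_on (\<lambda>(y, ys). y # ys) (A \<times> listset As)" by (auto intro: inj_onI)
  ultimately have "(\<Sum>ys\<in>listset (A # As). prod_list (map2 f (x # xs) ys))
      = (\<Sum>(y, ys)\<in>A \<times> listset As. f x y * prod_list (map2 f xs ys))"
    by (simp add: sum.reindex case_prod_unfold)
  also have "\<dots> = (\<Sum>y\<in>A. f x y) * (\<Sum>ys\<in>listset As. prod_list (map2 f xs ys))"
    by (simp add: sum_product sum.cartesian_product)
  finally show ?case using Cons.IH by simp
qed simp

lemma prod_list_all_one: "(\<And>x. x \<in> set xs \<Longrightarrow> f x = 1) \<Longrightarrow> prod_list (map f xs) = (1::'a::monoid_mult)"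
  by (induction xs) auto

lemma prod_list_two_factors:
  fixes a b :: "'a::monoid_mult"
  assumes "s < t" "t < n"
  shows "prod_list (map (\<lambda>r. if r = s then a else if r = t then b else 1) [0..<n]) = a * b"
proof -
  have "[0..<n] = [0..<s] @ s # [Suc s..<t] @ t # [Suc t..<n]"
    using assms upt_add_eq_append[of 0 s "n - s"] upt_add_eq_append[of "Suc s" t "n - t"]
    by (simp add: upt_conv_Cons)
  moreover have "prod_list (map (\<lambda>r. if r = s then a else if r = t then b else 1) xs) = 1"
    if "s \<notin> set xs" "t \<notin> set xs" for xs
    using that by (intro prod_list_all_one) auto
  ultimately show ?thesis using assms by simp
qed

text \<open>Used with the first and last positions, to fix end points, and with \<open>t\<close> and
  \<open>Suc t\<close>, to fix an edge. The lists need not be paths, since the row and column sums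
  range over all vertices.\<close>

definition lists_through :: "nat \<Rightarrow> nat \<Rightarrow> nat \<Rightarrow> 'v \<Rightarrow> 'v \<Rightarrow> 'v list set" where
  "lists_through n s t x y = {xs. length xs = n \<and> xs ! s = x \<and> xs ! t = y}"

lemma finite_lists_through [simp]: "finite (lists_through n s t x (y::'v::finite))"
  by (rule finite_subset[OF _ finite_lists_length_eq[of "UNIV::'v set" n]])
     (auto simp: lists_through_def)

lemma lists_through_eq_listset:
  assumes "s < t" "t < n"
  shows "lists_through n s t x y
       = listset (map (\<lambda>r. if r = s then {x} else if r = t then {y} else UNIV) [0..<n])"
proof (rule Set.set_eqI)
  fix xs :: "'a list"
  let ?A = "\<lambda>r. if r = s then {x} else if r = t then {y} else UNIV"
  have "xs \<in> listset (map ?A [0..<n]) \<longleftrightarrow> length xs = n \<and> (\<forall>i<n. xs ! i \<in> ?A i)"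
    unfolding in_listset_iff by simp
  also have "\<dots> \<longleftrightarrow> length xs = n \<and> xs ! s = x \<and> xs ! t = y"
    using assms by (auto split: if_splits)
  finally show "xs \<in> lists_through n s t x y \<longleftrightarrow> xs \<in> listset (map ?A [0..<n])"
    by (simp add: lists_through_def)
qed

section \<open>Walks and geodesics under the quantum automorphism group\<close>

definition walks :: "('v \<Rightarrow> 'v \<Rightarrow> bool) \<Rightarrow> nat \<Rightarrow> 'v \<Rightarrow> 'v \<Rightarrow> 'v list set" where
  "walks E n x y = {xs. graph_path E xs \<and> length xs = Suc n \<and> hd xs = x \<and> last xs = y}"

definition geodesic :: "('v \<Rightarrow> 'v \<Rightarrow> bool) \<Rightarrow> 'v list \<Rightarrow> bool" where
  "geodesic E xs \<longleftrightarrow> graph_path E xs \<and> graph_dist E (hd xs) (last xs) = length xs - 1"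

text \<open>Uniform probability on the shortest paths between the end points, extended by 0 to all
  lists. Walks whose length is the distance are exactly the geodesics, so \<open>walks\<close>
  supplies the normalization.\<close>

definition geodesic_weight :: "('v \<Rightarrow> 'v \<Rightarrow> bool) \<Rightarrow> 'v list \<Rightarrow> real" where
  "geodesic_weight E xs =
     (if geodesic E xs then 1 / card (walks E (length xs - 1) (hd xs) (last xs)) else 0)"

lemma path_between_iff_walks: "path_between E x y n \<longleftrightarrow> walks E n x y \<noteq> {}"
  by (auto simp: path_between_def walks_def)

lemma walks_conv_lists_through:
  "walks E n x y = {xs \<in> lists_through (Suc n) 0 n x y. graph_path E xs}"
proof -
  have "hd xs = xs ! 0 \<and> last xs = xs ! n" if "length xs = Suc n" for xs :: "'a list"
    using that by (cases xs) (auto simp: last_conv_nth)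
  then show ?thesis by (auto simp: walks_def lists_through_def)
qed

lemma finite_walks [simp]: "finite (walks E n x (y::'v::finite))"
  by (simp add: walks_conv_lists_through)

lemma path_monomial_append:
  "length xs = length ys \<Longrightarrow>
     path_monomial (xs @ xs') (ys @ ys') = path_monomial xs ys * path_monomial xs' ys'"
  by (simp add: path_monomial_def)

lemma path_monomial_Cons: "path_monomial (x # xs) (y # ys) = qgen x y * path_monomial xs ys"
  by (simp add: path_monomial_def)

lemma path_monomial_Nil [simp]: "path_monomial [] [] = 1"
  by (simp add: path_monomial_def)

section \<open>Path monomials modulo the quantum group relations\<close>

locale Gk_seminorm = cstar_seminorm_on "Gk_relations E k" p
  for E :: "'v::finite \<Rightarrow> 'v \<Rightarrow> bool" and k p
begin

lemma eqv_kills_aut: "x - y \<in> aut_plus_relations E \<Longrightarrow> x \<doteq> y"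
  by (rule eqv_kills) (simp add: Gk_relations_def)

lemma star_q: "free_star (qgen i j) \<doteq> qgen i j"
  and row_sum: "(\<Sum>j\<in>UNIV. qgen i j) \<doteq> 1"
  and column_sum: "(\<Sum>j\<in>UNIV. qgen j i) \<doteq> 1"
  and row_orthogonal: "qgen i j * qgen i l \<doteq> of_bool (j = l) * qgen i j"
  and column_orthogonal: "qgen j i * qgen l i \<doteq> of_bool (j = l) * qgen j i"
  and intertwines: "(\<Sum>l\<in>UNIV. qgen i l * of_bool (E l j)) \<doteq> (\<Sum>l\<in>UNIV. of_bool (E i l) * qgen l j)"
  by (rule eqv_kills_aut; unfold aut_plus_relations_def; blast)+

lemma norm_le_sum_cmod: "p x \<le> (\<Sum>w\<in>Poly_Mapping.keys x. cmod (Poly_Mapping.lookup x w))"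
proof (rule norm_le_sum_coeffs)
  fix g :: "'v \<times> 'v"
  obtain i j where g: "g = (i, j)" by (cases g)
  show "free_star (gen g) \<doteq> gen g" unfolding g by (rule star_q)
  show "gen g * gen g \<doteq> gen g" unfolding g using row_orthogonal[of i j j] by simp
qed

text \<open>Multiply the entry \<open>(i, j')\<close> of the intertwining relation by
  \<open>qgen i j\<close> on the left and \<open>qgen i' j'\<close> on the right. Row orthogonality
  leaves only \<open>l = j\<close> on one side, column orthogonality only \<open>l = i'\<close> on
  the other.\<close>

lemma adjacency_preserved:
  assumes "E i i' \<noteq> E j j'" shows "p (qgen i j * qgen i' j') = 0"
proof -
  let ?x = "qgen i j * qgen i' j'"
  have "of_bool (E j j') * ?x = (\<Sum>l\<in>UNIV. if l = j then of_bool (E l j') * ?x else 0)"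
    by simp
  also have "\<dots> = (\<Sum>l\<in>UNIV. (of_bool (j = l) * qgen i j) * (of_bool (E l j') * qgen i' j'))"
    by (intro sum.cong refl) auto
  also have "\<dots> \<doteq> (\<Sum>l\<in>UNIV. (qgen i j * qgen i l) * (of_bool (E l j') * qgen i' j'))"
    by (intro eqv_sum eqv_mult eqv_refl eqv_sym[OF row_orthogonal])
  also have "\<dots> = qgen i j * (\<Sum>l\<in>UNIV. qgen i l * of_bool (E l j')) * qgen i' j'"
    by (simp only: sum_distrib_left sum_distrib_right mult.assoc)
  also have "\<dots> \<doteq> qgen i j * (\<Sum>l\<in>UNIV. of_bool (E i l) * qgen l j') * qgen i' j'"
    by (intro eqv_mult eqv_refl intertwines)
  also have "\<dots> = (\<Sum>l\<in>UNIV. (qgen i j * of_bool (E i l)) * (qgen l j' * qgen i' j'))"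
    by (simp only: sum_distrib_left sum_distrib_right mult.assoc)
  also have "\<dots> \<doteq> (\<Sum>l\<in>UNIV. (qgen i j * of_bool (E i l)) * (of_bool (l = i') * qgen l j'))"
    by (intro eqv_sum eqv_mult eqv_refl column_orthogonal)
  also have "\<dots> = (\<Sum>l\<in>UNIV. if l = i' then of_bool (E i l) * (qgen i j * qgen l j') else 0)"
    by (intro sum.cong refl) auto
  also have "\<dots> = of_bool (E i i') * ?x" by simp
  finally have "of_bool (E j j') * ?x \<doteq> of_bool (E i i') * ?x" .
  then show ?thesis using assms by (auto simp: eqv_def minus)
qed

lemma equality_preserved:
  assumes "(i = i') \<noteq> (j = j')" shows "p (qgen i j * qgen i' j') = 0"
proof (cases "i = i'")
  case True
  then show ?thesis using assms row_orthogonal[of i j j'] by (simp add: eqv_zero_iff)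
next
  case False
  then show ?thesis using assms column_orthogonal[of i j i'] by (simp add: eqv_zero_iff)
qed

lemma path_monomial_reverse:
  assumes "graph_path E xs" "graph_path E ys" "length xs = length ys" "length xs \<le> k + 1"
  shows "path_monomial xs ys \<doteq> path_monomial (rev xs) (rev ys)"
  using assms by (intro eqv_kills) (auto simp: Gk_relations_def)

text \<open>The two consecutive factors can be isolated in the product, and the kernel of
  \<open>p\<close> is a two-sided ideal.\<close>

lemma path_monomial_null_step:
  assumes "length xs = length ys" "Suc i < length xs"
    and "p (qgen (xs ! i) (ys ! i) * qgen (xs ! Suc i) (ys ! Suc i)) = 0"
  shows "p (path_monomial xs ys) = 0"
proof -
  have split: "zs = take i zs @ zs ! i # zs ! Suc i # drop (Suc (Suc i)) zs"
    if "Suc i < length zs" for zs :: "'v list"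
    using that by (metis Cons_nth_drop_Suc Suc_lessD append_take_drop_id)
  have "path_monomial xs ys = path_monomial (take i xs) (take i ys) *
      ((qgen (xs ! i) (ys ! i) * qgen (xs ! Suc i) (ys ! Suc i)) *
       path_monomial (drop (Suc (Suc i)) xs) (drop (Suc (Suc i)) ys))"
    using assms(1,2) split[of xs] split[of ys]
      path_monomial_append[of "take i xs" "take i ys" "drop i xs" "drop i ys"]
    by (simp add: path_monomial_Cons mult.assoc flip: Cons_nth_drop_Suc)
  then show ?thesis using assms(3) by (simp add: null_mult_left null_mult_right)
qed

text \<open>Otherwise some step is an edge in just one of the lists, and its two factors have a null
  product.\<close>

lemma path_preserved:
  assumes "length xs = length ys" "p (path_monomial xs ys) \<noteq> 0"
  shows "graph_path E xs \<longleftrightarrow> graph_path E ys"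
proof -
  have "E (xs ! i) (xs ! Suc i) = E (ys ! i) (ys ! Suc i)" if "Suc i < length xs" for i
    using path_monomial_null_step[OF assms(1) that] adjacency_preserved assms(2) by blast
  then show ?thesis using assms(1) by (auto simp: graph_path_def successively_conv_nth)
qed

text \<open>Reversing both halves of a path of length at most \<open>2 * k + 1\<close> brings the two factors
  belonging to its end points next to each other.\<close>

lemma path_monomial_null_ends:
  assumes xs: "graph_path E xs" and ys: "graph_path E ys"
    and len: "length ys = length xs" "2 \<le> length xs" "length xs \<le> 2 * k + 2"
    and null: "p (qgen (hd xs) (hd ys) * qgen (last xs) (last ys)) = 0"
  shows "p (path_monomial xs ys) = 0"
proof -
  \<comment> \<open>The cut leaves two nonempty halves of at most \<open>k + 1\<close> vertices
    each, the range of the reversal relations; hence the limit \<open>2 * k + 2\<close>.\<close>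
  define m where "m = min (k + 1) (length xs - 1)"
  have m: "0 < m" "m < length xs" "m \<le> k + 1" "length xs - m \<le> k + 1"
    using len by (auto simp: m_def)
  have halves: "\<exists>u v. take m zs = hd zs # u \<and> drop m zs = v @ [last zs] \<and>
      Suc (length u) = m \<and> Suc (length v) = length xs - m"
    if "length zs = length xs" for zs :: "'v list"
  proof (intro exI conjI)
    show "take m zs = hd zs # tl (take m zs)"
      using m that by (cases zs; cases m) auto
    show "drop m zs = butlast (drop m zs) @ [last zs]"
      using m that by (metis append_butlast_last_id drop_eq_Nil last_drop not_le)
  qed (use m that in auto)
  obtain u v where u: "take m xs = hd xs # u" "drop m xs = v @ [last xs]"
      "Suc (length u) = m" "Suc (length v) = length xs - m"
    using halves[of xs] by blast
  obtain u' v' where u': "take m ys = hd ys # u'" "drop m ys = v' @ [last ys]"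
      "Suc (length u') = m" "Suc (length v') = length xs - m"
    using halves[of ys] len by auto
  have paths: "graph_path E (take m zs) \<and> graph_path E (drop m zs)"
    if "graph_path E zs" "length zs = length xs" for zs
    using that m successively_append_iff[of E "take m zs" "drop m zs"]
    by (auto simp: graph_path_def)
  have lens: "length u = length u'" "length v = length v'" using u u' by auto
  have "path_monomial xs ys
      = path_monomial (take m xs) (take m ys) * path_monomial (drop m xs) (drop m ys)"
    using path_monomial_append[of "take m xs" "take m ys" "drop m xs" "drop m ys"] len by simp
  also have "\<dots> \<doteq> path_monomial (rev (take m xs)) (rev (take m ys)) *
                path_monomial (rev (drop m xs)) (rev (drop m ys))"
    using paths[OF xs] paths[OF ys] len m by (intro eqv_mult path_monomial_reverse) auto
  also have "\<dots> = path_monomial (rev u) (rev u') *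
      ((qgen (hd xs) (hd ys) * qgen (last xs) (last ys)) * path_monomial (rev v) (rev v'))"
    using lens by (simp add: u u' path_monomial_append path_monomial_Cons mult.assoc)
  finally show ?thesis
    using null eqv_norm by (simp add: null_mult_left null_mult_right)
qed

section \<open>Double counting of path monomials\<close>

lemma sum_over_targets:
  assumes "s < t" "t < n" "length xs = n"
  shows "(\<Sum>ys\<in>lists_through n s t x' y'. path_monomial xs ys)
       \<doteq> qgen (xs ! s) x' * qgen (xs ! t) y'"
proof -
  let ?A = "\<lambda>r. if r = s then {x'} else if r = t then {y'} else UNIV"
  have "(\<Sum>ys\<in>lists_through n s t x' y'. path_monomial xs ys)
      = prod_list (map2 (\<lambda>x A. \<Sum>y\<in>A. qgen x y) xs (map ?A [0..<n]))"
    using assms unfolding lists_through_eq_listset[OF assms(1,2)] path_monomial_def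
    by (intro sum_listset_prod_list) simp
  also have "map2 (\<lambda>x A. \<Sum>y\<in>A. qgen x y) xs (map ?A [0..<n])
      = map (\<lambda>r. \<Sum>y\<in>?A r. qgen (xs ! r) y) [0..<n]"
    using assms(3) by (intro nth_equalityI) auto
  also have "prod_list \<dots> \<doteq> prod_list (map (\<lambda>r. if r = s then qgen (xs ! s) x'
      else if r = t then qgen (xs ! t) y' else 1) [0..<n])"
    by (intro eqv_prod_list) (auto simp: list_all2_conv_all_nth row_sum)
  also have "\<dots> = qgen (xs ! s) x' * qgen (xs ! t) y'" by (rule prod_list_two_factors) fact+
  finally show ?thesis .
qed

lemma sum_over_sources:
  assumes "s < t" "t < n" "length ys = n"
  shows "(\<Sum>xs\<in>lists_through n s t x y. path_monomial xs ys)
       \<doteq> qgen x (ys ! s) * qgen y (ys ! t)"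
proof -
  let ?A = "\<lambda>r. if r = s then {x} else if r = t then {y} else UNIV"
  \<comment> \<open>The sum now runs over the first index of each generator, so the lists are
    swapped to match \<open>sum_listset_prod_list\<close>.\<close>
  have "path_monomial xs ys = prod_list (map2 (\<lambda>y x. qgen x y) ys xs)" for xs
    unfolding path_monomial_def by (subst zip_commute) (simp add: case_prod_unfold comp_def)
  then have "(\<Sum>xs\<in>lists_through n s t x y. path_monomial xs ys)
      = prod_list (map2 (\<lambda>y A. \<Sum>x\<in>A. qgen x y) ys (map ?A [0..<n]))"
    using assms(3) sum_listset_prod_list[of ys "map ?A [0..<n]" "\<lambda>y x. qgen x y"]
    unfolding lists_through_eq_listset[OF assms(1,2)] by simp
  also have "map2 (\<lambda>y A. \<Sum>x\<in>A. qgen x y) ys (map ?A [0..<n])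
      = map (\<lambda>r. \<Sum>x\<in>?A r. qgen x (ys ! r)) [0..<n]"
    using assms(3) by (intro nth_equalityI) auto
  also have "prod_list \<dots> \<doteq> prod_list (map (\<lambda>r. if r = s then qgen x (ys ! s)
      else if r = t then qgen y (ys ! t) else 1) [0..<n])"
    by (intro eqv_prod_list) (auto simp: list_all2_conv_all_nth column_sum)
  also have "\<dots> = qgen x (ys ! s) * qgen y (ys ! t)" by (rule prod_list_two_factors) fact+
  finally show ?thesis .
qed

text \<open>The double sum of \<open>w xs * path_monomial xs ys\<close> is evaluated twice: summing
  over targets first gives the left sum times the nonnull product, summing over sources first gives
  the right sum times the same product.\<close>

lemma sum_invariant_weight:
  fixes w :: "'v list \<Rightarrow> real"
  assumes "s < t" "t < n"
    and invariant: "\<And>xs ys. \<lbrakk>length xs = n; length ys = n; p (path_monomial xs ys) \<noteq> 0\<rbrakk>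
      \<Longrightarrow> w xs = w ys"
    and nonnull: "p (qgen x x' * qgen y y') \<noteq> 0"
  shows "(\<Sum>xs\<in>lists_through n s t x y. w xs) = (\<Sum>ys\<in>lists_through n s t x' y'. w ys)"
proof -
  let ?c = "\<lambda>r. Poly_Mapping.single 0 (complex_of_real r) :: ('v \<times> 'v) free_star_alg"
  let ?X = "lists_through n s t x y" and ?Y = "lists_through n s t x' y'"
  let ?q = "qgen x x' * qgen y y'"
  have c_add: "?c (a + b) = ?c a + ?c b" for a b by (simp add: single_add)
  have c_sum: "?c (sum f A) = (\<Sum>a\<in>A. ?c (f a))" for f and A :: "'v list set"
    by (induction A rule: infinite_finite_induct) (simp_all only: c_add sum.insert sum.infinite sum.empty of_real_0 single_zero not_False_eq_True)
  have norm_c: "p (?c r * z) = \<bar>r\<bar> * p z" for r z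
    using scale[of "complex_of_real r" z] by (simp add: free_scale_def)
  have "?c (sum w ?X) * ?q = (\<Sum>xs\<in>?X. ?c (w xs) * ?q)"
    unfolding c_sum by (rule sum_distrib_right)
  also have "\<dots> \<doteq> (\<Sum>xs\<in>?X. ?c (w xs) * (\<Sum>ys\<in>?Y. path_monomial xs ys))"
    using eqv_sym[OF sum_over_targets[OF assms(1,2), of _ x' y']]
    by (intro eqv_sum eqv_mult eqv_refl) (auto simp: lists_through_def)
  also have "\<dots> = (\<Sum>xs\<in>?X. \<Sum>ys\<in>?Y. ?c (w xs) * path_monomial xs ys)"
    by (simp add: sum_distrib_left)
  \<comment> \<open>Where the two weights differ, the monomial is null by
    \<open>invariant\<close>.\<close>
  also have "\<dots> \<doteq> (\<Sum>xs\<in>?X. \<Sum>ys\<in>?Y. ?c (w ys) * path_monomial xs ys)"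
  proof (intro eqv_sum)
    fix xs ys assume "xs \<in> ?X" "ys \<in> ?Y"
    then show "?c (w xs) * path_monomial xs ys \<doteq> ?c (w ys) * path_monomial xs ys"
      using invariant[of xs ys]
      by (cases "p (path_monomial xs ys) = 0")
         (auto simp: lists_through_def eqv_def null_mult_left simp flip: left_diff_distrib)
  qed
  also have "\<dots> = (\<Sum>ys\<in>?Y. ?c (w ys) * (\<Sum>xs\<in>?X. path_monomial xs ys))"
    by (subst sum.swap) (simp add: sum_distrib_left)
  also have "\<dots> \<doteq> (\<Sum>ys\<in>?Y. ?c (w ys) * ?q)"
    using sum_over_sources[OF assms(1,2), of _ x y]
    by (intro eqv_sum eqv_mult eqv_refl) (auto simp: lists_through_def)
  also have "\<dots> = ?c (sum w ?Y) * ?q"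
    unfolding c_sum by (rule sum_distrib_right[symmetric])
  finally have "p (?c (sum w ?X - sum w ?Y) * ?q) = 0"
    by (simp add: eqv_def single_diff left_diff_distrib)
  then show ?thesis using nonnull by (simp only: norm_c) simp
qed

text \<open>The weight is the indicator of being a path. Length 0 is separate because the double
  counting requires two distinct positions.\<close>

lemma card_walks_preserved:
  assumes "p (qgen x x' * qgen y y') \<noteq> 0"
  shows "card (walks E n x y) = card (walks E n x' y')"
proof (cases "n = 0")
  case True
  have "walks E 0 a b = (if a = b then {[a]} else {})" for a b
    by (auto simp: walks_def graph_path_def length_Suc_conv)
  moreover have "(x = y) = (x' = y')" using equality_preserved assms by blast
  ultimately show ?thesis using True by simp
next
  case False
  have "real (card (walks E n a b))
      = (\<Sum>xs\<in>lists_through (Suc n) 0 n a b. of_bool (graph_path E xs))" for a b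
    by (simp add: walks_conv_lists_through Int_def)
  moreover have "(\<Sum>xs\<in>lists_through (Suc n) 0 n x y. of_bool (graph_path E xs) :: real)
      = (\<Sum>xs\<in>lists_through (Suc n) 0 n x' y'. of_bool (graph_path E xs))"
  proof (rule sum_invariant_weight)
    fix xs ys assume "length xs = Suc n" "length ys = Suc n" "p (path_monomial xs ys) \<noteq> 0"
    then have "graph_path E xs = graph_path E ys" by (intro path_preserved) simp_all
    then show "(of_bool (graph_path E xs) :: real) = of_bool (graph_path E ys)" by (rule arg_cong)
  qed (use False assms in auto)
  ultimately show ?thesis by simp
qed

lemma graph_dist_preserved:
  assumes "p (qgen x x' * qgen y y') \<noteq> 0"
  shows "graph_dist E x y = graph_dist E x' y'"
proof -
  have "path_between E x y n \<longleftrightarrow> path_between E x' y' n" for n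
    using card_walks_preserved[OF assms, of n]
    by (metis card_0_eq finite_walks path_between_iff_walks)
  then show ?thesis by (simp add: graph_dist_def)
qed

text \<open>For paths, a nonnull monomial forces a nonnull product of the end point generators, so
  distance and number of walks agree for the two pairs of end points.\<close>

lemma geodesic_weight_preserved:
  assumes "length xs = length ys" "2 \<le> length xs" "length xs \<le> 2 * k + 2"
    and "p (path_monomial xs ys) \<noteq> 0"
  shows "geodesic_weight E xs = geodesic_weight E ys"
proof (cases "graph_path E xs")
  case True
  then have "graph_path E ys" using path_preserved assms by blast
  then have "p (qgen (hd xs) (hd ys) * qgen (last xs) (last ys)) \<noteq> 0"
    using path_monomial_null_ends[of xs ys] True assms by auto
  then show ?thesis
    using True \<open>graph_path E ys\<close> assms(1) graph_dist_preserved card_walks_preserved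
    by (simp add: geodesic_weight_def geodesic_def)
next
  case False
  then show ?thesis using path_preserved assms by (simp add: geodesic_weight_def geodesic_def)
qed

text \<open>A path of length \<open>n\<close> has \<open>n + 1\<close> vertices, so the bound on
  \<open>n\<close> is the range of \<open>geodesic_weight_preserved\<close>.\<close>

lemma geodesic_load_preserved:
  assumes "t < n" "n \<le> 2 * k + 1" "p (qgen x x' * qgen y y') \<noteq> 0"
  shows "sum (geodesic_weight E) (lists_through (Suc n) t (Suc t) x y)
       = sum (geodesic_weight E) (lists_through (Suc n) t (Suc t) x' y')"
  using assms by (intro sum_invariant_weight geodesic_weight_preserved) auto

end

section \<open>From k-equivalence to a nonnull monomial\<close>

lemma bounded_Gk_relations: "bounded_relations (Gk_relations E k)"
proof
  fix x :: "('a \<times> 'a) free_star_alg"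
  have "p x \<le> (\<Sum>w\<in>Poly_Mapping.keys x. cmod (Poly_Mapping.lookup x w))"
    if "cstar_seminorm p" "\<forall>r\<in>Gk_relations E k. p r = 0" for p
  proof -
    interpret Gk_seminorm E k p using that by unfold_locales auto
    show ?thesis by (rule norm_le_sum_cmod)
  qed
  then show "bdd_above ((\<lambda>p. p x) ` {p. cstar_seminorm p \<and> (\<forall>r\<in>Gk_relations E k. p r = 0)})"
    by (auto intro!: bdd_aboveI)
qed

text \<open>The product in \<open>k_equivalent\<close> is the class of the constant sequence
  \<open>path_monomial xs ys\<close>, and a nonzero class is detected by some seminorm.\<close>

lemma k_equivalent_nonnull:
  assumes "k_equivalent E k xs ys"
  obtains p where "Gk_seminorm E k p" "p (path_monomial xs ys) \<noteq> 0"
proof -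
  interpret bounded_relations "Gk_relations E k" by (rule bounded_Gk_relations)
  have map2_q: "map2 (q_Gk E k) xs ys
      = map (\<lambda>x. univ_class (Gk_relations E k) (\<lambda>_. x)) (map2 qgen xs ys)"
    by (simp add: q_Gk_def univ_gen_def)
  have "univ_class (Gk_relations E k) (\<lambda>_. path_monomial xs ys)
      \<noteq> \<zero>\<^bsub>universal_cstar (Gk_relations E k)\<^esub>"
    using assms unfolding k_equivalent_def C_Gk_def path_monomial_def
      map2_q foldr_mult_univ_class by (elim conjE)
  then show ?thesis using univ_class_const_nonzero that unfolding Gk_seminorm_def by blast
qed

section \<open>Real symmetric matrices\<close>

lemma symmetric_matrix_inner:
  fixes A :: "real ^ 'n ^ 'n"
  assumes "transpose A = A" shows "(A *v x) \<bullet> y = x \<bullet> (A *v y)"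
  by (metis assms dot_lmul_matrix transpose_matrix_vector)

text \<open>Eigenvectors of distinct eigenvalues are orthogonal, hence independent, hence finite in
  number. This lets \<open>Min\<close> in \<open>lambda1\<close> be attained.\<close>

lemma finite_real_eigenvalues:
  fixes A :: "real ^ 'n ^ 'n"
  assumes sym: "transpose A = A"
  shows "finite {\<mu>. real_eigenvalue A \<mu>}"
proof -
  define v where "v \<mu> = (SOME x. x \<noteq> 0 \<and> A *v x = \<mu> *\<^sub>R x)" for \<mu>
  have v: "v \<mu> \<noteq> 0" "A *v v \<mu> = \<mu> *\<^sub>R v \<mu>" if "real_eigenvalue A \<mu>" for \<mu>
    using that someI_ex[of "\<lambda>x. x \<noteq> 0 \<and> A *v x = \<mu> *\<^sub>R x"]
    by (auto simp: v_def real_eigenvalue_def)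
  have orth: "v \<mu> \<bullet> v \<nu> = 0"
    if "real_eigenvalue A \<mu>" "real_eigenvalue A \<nu>" "\<mu> \<noteq> \<nu>" for \<mu> \<nu>
    using symmetric_matrix_inner[OF sym, of "v \<mu>" "v \<nu>"] that by (simp add: v)
  let ?S = "{\<mu>. real_eigenvalue A \<mu>}"
  have "inj_on v ?S"
    by (rule inj_onI) (metis orth v(1) inner_eq_zero_iff mem_Collect_eq)
  moreover have "independent (v ` ?S)"
    by (rule pairwise_orthogonal_independent)
       (auto simp: pairwise_def orthogonal_def v(1) intro: orth)
  then have "finite (v ` ?S)" by (rule independent_imp_finite)
  ultimately show ?thesis by (simp add: finite_image_iff)
qed

text \<open>The Rayleigh quotient attains its maximum on the compact unit sphere, and a maximizer is
  an eigenvector. This will supply a nonzero eigenvalue of the Laplacian.\<close>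

lemma maximal_real_eigenvalue:
  fixes A :: "real ^ 'n ^ 'n"
  assumes sym: "transpose A = A"
  obtains \<mu> where "real_eigenvalue A \<mu>" "\<And>x. x \<bullet> (A *v x) \<le> \<mu> * (x \<bullet> x)"
proof -
  have "continuous_on (sphere 0 1) (\<lambda>x. x \<bullet> (A *v x))"
    by (intro continuous_intros matrix_vector_mult_linear_continuous_on)
  moreover have "sphere (0 :: real ^ 'n) 1 \<noteq> {}" by simp
  ultimately have "\<exists>u\<in>sphere 0 1. \<forall>y\<in>sphere 0 1. y \<bullet> (A *v y) \<le> u \<bullet> (A *v u)"
    by (intro continuous_attains_sup compact_sphere)
  then obtain u where u: "norm u = 1"
      and max: "\<And>y. norm y = 1 \<Longrightarrow> y \<bullet> (A *v y) \<le> u \<bullet> (A *v u)"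
    by auto
  define M where "M = u \<bullet> (A *v u)"
  have bound: "x \<bullet> (A *v x) \<le> M * (x \<bullet> x)" for x
  proof (cases "x = 0")
    case False
    have "(inverse (norm x) *\<^sub>R x) \<bullet> (A *v (inverse (norm x) *\<^sub>R x)) \<le> M"
      unfolding M_def using False by (intro max) simp
    then have "x \<bullet> (A *v x) \<le> M * (norm x)\<^sup>2"
      using False by (simp add: matrix_vector_mult_scaleR field_simps power2_eq_square)
    then show ?thesis by (simp add: power2_norm_eq_inner)
  qed simp
  \<comment> \<open>The residual of the eigenvalue equation. If it were nonzero, moving
    \<open>u\<close> along a negative multiple of it would violate \<open>bound\<close>.\<close>
  define z where "z = M *\<^sub>R u - A *v u"
  have "z = 0"
  proof (rule ccontr)
    assume "z \<noteq> 0"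
    then have zz: "0 < z \<bullet> z" by simp
    define q where "q = M * (z \<bullet> z) - z \<bullet> (A *v z)"
    have q: "0 \<le> q" using bound[of z] by (simp add: q_def)
    have uu: "u \<bullet> u = 1" using u by (simp add: norm_eq_1)
    have expand: "M * ((u + t *\<^sub>R z) \<bullet> (u + t *\<^sub>R z)) - (u + t *\<^sub>R z) \<bullet> (A *v (u + t *\<^sub>R z))
        = 2 * t * (z \<bullet> z) + t\<^sup>2 * q" for t
    proof -
      have zAu: "z \<bullet> (A *v u) = M * (z \<bullet> u) - z \<bullet> z"
        using inner_diff_right[of z "M *\<^sub>R u" "A *v u"] by (simp flip: z_def)
      have uAz: "u \<bullet> (A *v z) = M * (z \<bullet> u) - z \<bullet> z"
        using symmetric_matrix_inner[OF sym, of u z] zAu by (simp add: inner_commute)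
      have uAu: "u \<bullet> (A *v u) = M" by (simp add: M_def)
      show ?thesis
        by (simp add: zAu uAz uAu matrix_vector_right_distrib matrix_vector_mult_scaleR inner_add_left
            inner_add_right uu q_def inner_commute[of u z] algebra_simps power2_eq_square)
    qed
    \<comment> \<open>This choice turns the quadratic into
      \<open>t * (z \<bullet> z) - t\<^sup>2\<close>; the \<open>+ 1\<close> keeps the denominator
      positive when \<open>q = 0\<close>.\<close>
    define t where "t = - (z \<bullet> z) / (q + 1)"
    have t: "t < 0" "t * (q + 1) = - (z \<bullet> z)"
      using q zz by (simp_all add: t_def divide_neg_pos)
    have "0 \<le> 2 * t * (z \<bullet> z) + t\<^sup>2 * q"
      using bound[of "u + t *\<^sub>R z"] expand[of t] by simp
    also have "\<dots> = 2 * t * (z \<bullet> z) + t * (t * (q + 1)) - t\<^sup>2"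
      by (simp add: algebra_simps power2_eq_square)
    also have "\<dots> = t * (z \<bullet> z) - t\<^sup>2"
      unfolding t(2) by (simp add: algebra_simps)
    also have "\<dots> < 0" using t(1) zz mult_neg_pos[of t "z \<bullet> z"] by (simp add: diff_less_0_iff_less less_le_trans)
    finally show False by simp
  qed
  then have "real_eigenvalue A M"
    using u by (auto simp: real_eigenvalue_def z_def intro!: exI[of _ u])
  then show ?thesis using bound that by blast
qed

section \<open>The load of an edge\<close>

text \<open>Splitting by length and position gives inner sums of the form treated by
  \<open>geodesic_load_preserved\<close>. Every geodesic has length at most
  \<open>diam E\<close>.\<close>

definition geodesic_load :: "('v::finite \<Rightarrow> 'v \<Rightarrow> bool) \<Rightarrow> 'v \<Rightarrow> 'v \<Rightarrow> real" where
  "geodesic_load E a b =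
     (\<Sum>n\<le>diam E. \<Sum>t<n. sum (geodesic_weight E) (lists_through (Suc n) t (Suc t) a b))"

lemma geodesic_weight_nonneg: "0 \<le> geodesic_weight E xs"
  by (simp add: geodesic_weight_def)

lemma geodesic_load_nonneg: "0 \<le> geodesic_load E a b"
  unfolding geodesic_load_def by (intro sum_nonneg geodesic_weight_nonneg)

lemma geodesic_load_non_edge: "\<not> E a b \<Longrightarrow> geodesic_load E a b = 0"
  unfolding geodesic_load_def
  by (intro sum.neutral ballI)
     (auto simp: geodesic_weight_def geodesic_def graph_path_def lists_through_def
       successively_conv_nth)

lemma geodesic_load_k_equivalent:
  assumes "k_equivalent E k [a, b] [c, d]" "diam E \<le> 2 * k + 1"
  shows "geodesic_load E a b = geodesic_load E c d"
proof -
  obtain p where "Gk_seminorm E k p" and p: "p (path_monomial [a, b] [c, d]) \<noteq> 0"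
    using assms(1) by (rule k_equivalent_nonnull)
  then interpret Gk_seminorm E k p by simp
  have "p (qgen a c * qgen b d) \<noteq> 0" using p by (simp add: path_monomial_Cons)
  then show ?thesis
    unfolding geodesic_load_def using assms(2) by (intro sum.cong refl geodesic_load_preserved) auto
qed

lemma graph_dist_le_diam: "graph_dist E x y \<le> diam E"
proof -
  have "{graph_dist E i j | i j. True} = range (\<lambda>(i, j). graph_dist E i j)" by auto
  then show ?thesis unfolding diam_def by (intro Max_ge) auto
qed

lemma geodesics_nonempty: "connected_graph E \<Longrightarrow> walks E (graph_dist E x y) x y \<noteq> {}"
  unfolding path_between_iff_walks[symmetric] connected_graph_def graph_dist_def
  by (blast intro: LeastI_ex)

lemma sum_lists_by_entries:
  fixes h :: "'v::finite list \<Rightarrow> real"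
  shows "(\<Sum>xs | length xs = n. h xs) = (\<Sum>a\<in>UNIV. \<Sum>b\<in>UNIV. sum h (lists_through n s t a b))"
proof -
  have "(\<Sum>a\<in>UNIV. \<Sum>b\<in>UNIV. sum h (lists_through n s t a b))
      = (\<Sum>q\<in>UNIV. sum h {xs \<in> {xs. length xs = n}. (xs ! s, xs ! t) = q})"
    unfolding sum.cartesian_product UNIV_Times_UNIV
    by (intro sum.cong refl) (auto simp: lists_through_def)
  also have "\<dots> = (\<Sum>xs | length xs = n. h xs)"
    using finite_lists_length_eq[of "UNIV::'v set" n] by (intro sum.group) auto
  finally show ?thesis ..
qed

text \<open>Both sides add up \<open>g\<close> over the steps of random shortest paths: the left
  groups steps by edge, the right groups paths by end points. It is applied to \<open>g = 1\<close>
  and to squared differences.\<close>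

lemma sum_geodesic_load:
  fixes E :: "'v::finite \<Rightarrow> 'v \<Rightarrow> bool" and g :: "'v \<Rightarrow> 'v \<Rightarrow> real"
  shows "(\<Sum>a\<in>UNIV. \<Sum>b\<in>UNIV. geodesic_load E a b * g a b)
    = (\<Sum>x\<in>UNIV. \<Sum>y\<in>UNIV. \<Sum>xs\<in>walks E (graph_dist E x y) x y.
        (\<Sum>t<graph_dist E x y. g (xs ! t) (xs ! Suc t)) / card (walks E (graph_dist E x y) x y))"
proof -
  let ?w = "geodesic_weight E" and ?D = "diam E"
  have swap: "(\<Sum>a\<in>UNIV. \<Sum>b\<in>UNIV. \<Sum>n\<in>N. K a b n) = (\<Sum>n\<in>N. \<Sum>a\<in>UNIV. \<Sum>b\<in>UNIV. K a b n)"
    for K :: "'v \<Rightarrow> 'v \<Rightarrow> nat \<Rightarrow> real" and N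
  proof -
    have "(\<Sum>a\<in>UNIV. \<Sum>b\<in>UNIV. \<Sum>n\<in>N. K a b n) = (\<Sum>a\<in>UNIV. \<Sum>n\<in>N. \<Sum>b\<in>UNIV. K a b n)"
      by (intro sum.cong refl sum.swap)
    also have "\<dots> = (\<Sum>n\<in>N. \<Sum>a\<in>UNIV. \<Sum>b\<in>UNIV. K a b n)" by (rule sum.swap)
    finally show ?thesis .
  qed
  let ?G = "\<lambda>n x y. \<Sum>xs\<in>walks E n x y. (\<Sum>t<n. g (xs ! t) (xs ! Suc t)) / card (walks E n x y)"
  have "(\<Sum>a\<in>UNIV. \<Sum>b\<in>UNIV. geodesic_load E a b * g a b)
      = (\<Sum>a\<in>UNIV. \<Sum>b\<in>UNIV. \<Sum>n\<le>?D. \<Sum>t<n. \<Sum>xs\<in>lists_through (Suc n) t (Suc t) a b.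
          ?w xs * g (xs ! t) (xs ! Suc t))"
    by (auto simp: geodesic_load_def sum_distrib_right lists_through_def intro!: sum.cong)
  also have "\<dots> = (\<Sum>n\<le>?D. \<Sum>t<n. \<Sum>a\<in>UNIV. \<Sum>b\<in>UNIV. \<Sum>xs\<in>lists_through (Suc n) t (Suc t) a b.
          ?w xs * g (xs ! t) (xs ! Suc t))"
    by (simp only: swap)
  \<comment> \<open>Summing over the entries at \<open>t\<close> and \<open>Suc t\<close> frees
    them; afterwards the lists are split again by first and last entry.\<close>
  also have "\<dots> = (\<Sum>n\<le>?D. \<Sum>t<n. \<Sum>xs | length xs = Suc n. ?w xs * g (xs ! t) (xs ! Suc t))"
    by (intro sum.cong refl sum_lists_by_entries[symmetric])
  also have "\<dots> = (\<Sum>n\<le>?D. \<Sum>xs | length xs = Suc n. ?w xs * (\<Sum>t<n. g (xs ! t) (xs ! Suc t)))"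
    unfolding sum_distrib_left by (intro sum.cong refl sum.swap)
  also have "\<dots> = (\<Sum>n\<le>?D. \<Sum>x\<in>UNIV. \<Sum>y\<in>UNIV. \<Sum>xs\<in>lists_through (Suc n) 0 n x y.
      ?w xs * (\<Sum>t<n. g (xs ! t) (xs ! Suc t)))"
    by (intro sum.cong refl sum_lists_by_entries)
  \<comment> \<open>The weight lives on geodesics, so only \<open>n = graph_dist E x y\<close>
    survives, and this value is within the diameter.\<close>
  also have "\<dots> = (\<Sum>n\<le>?D. \<Sum>x\<in>UNIV. \<Sum>y\<in>UNIV. if n = graph_dist E x y then ?G n x y else 0)"
  proof (intro sum.cong refl)
    fix n and x y :: 'v
    have ends: "hd xs = x" "last xs = y" "length xs = Suc n" if "xs \<in> lists_through (Suc n) 0 n x y" for xs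
      using that by (cases xs; auto simp: lists_through_def last_conv_nth)+
    have "(\<Sum>xs\<in>lists_through (Suc n) 0 n x y. ?w xs * (\<Sum>t<n. g (xs ! t) (xs ! Suc t)))
      = (\<Sum>xs\<in>lists_through (Suc n) 0 n x y. if graph_path E xs then
           (if n = graph_dist E x y then (\<Sum>t<n. g (xs ! t) (xs ! Suc t)) / card (walks E n x y) else 0)
           else 0)"
      by (intro sum.cong refl) (auto simp: ends geodesic_weight_def geodesic_def)
    also have "\<dots> = (if n = graph_dist E x y then ?G n x y else 0)"
      by (simp add: walks_conv_lists_through sum.inter_filter[symmetric])
    finally show "(\<Sum>xs\<in>lists_through (Suc n) 0 n x y. ?w xs * (\<Sum>t<n. g (xs ! t) (xs ! Suc t)))
      = (if n = graph_dist E x y then ?G n x y else 0)" .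
  qed
  also have "\<dots> = (\<Sum>x\<in>UNIV. \<Sum>y\<in>UNIV. \<Sum>n\<le>?D. if n = graph_dist E x y then ?G n x y else 0)"
    by (rule swap[symmetric])
  also have "\<dots> = (\<Sum>x\<in>UNIV. \<Sum>y\<in>UNIV. ?G (graph_dist E x y) x y)"
    by (simp add: graph_dist_le_diam)
  finally show ?thesis .
qed

text \<open>For \<open>g = 1\<close> each ordered pair contributes at most its distance.\<close>

lemma sum_geodesic_load_le:
  fixes E :: "'v::finite \<Rightarrow> 'v \<Rightarrow> bool"
  shows "(\<Sum>a\<in>UNIV. \<Sum>b\<in>UNIV. geodesic_load E a b) \<le> real (diam E) * (real CARD('v))\<^sup>2"
proof -
  have term_le: "(\<Sum>xs\<in>walks E (graph_dist E x y) x y. (\<Sum>t<graph_dist E x y. 1)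
      / card (walks E (graph_dist E x y) x y)) \<le> real (diam E)" for x y
    using graph_dist_le_diam[of E x y] by simp
  have "(\<Sum>a\<in>UNIV. \<Sum>b\<in>UNIV. geodesic_load E a b) \<le> (\<Sum>x\<in>(UNIV::'v set). \<Sum>y\<in>(UNIV::'v set). real (diam E))"
    using sum_geodesic_load[of E "\<lambda>_ _. 1"] sum_mono[OF sum_mono[OF term_le]]
    by (simp only: mult_1_right)
  then show ?thesis by (simp add: power2_eq_square algebra_simps)
qed

lemma square_diff_along_walk:
  fixes f :: "'v \<Rightarrow> real"
  assumes "xs \<in> walks E n x y"
  shows "(f x - f y)\<^sup>2 \<le> real n * (\<Sum>t<n. (f (xs ! t) - f (xs ! Suc t))\<^sup>2)"
proof -
  have "xs ! 0 = x" "xs ! n = y"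
    using assms by (auto simp: walks_conv_lists_through lists_through_def)
  then have "f x - f y = (\<Sum>t<n. f (xs ! t) - f (xs ! Suc t))"
    using sum_lessThan_telescope'[of "\<lambda>t. f (xs ! t)" n] by simp
  also have "\<dots>\<^sup>2 \<le> real n * (\<Sum>t<n. (f (xs ! t) - f (xs ! Suc t))\<^sup>2)"
    using sum_squared_le_sum_of_squares[of "\<lambda>t. f (xs ! t) - f (xs ! Suc t)" "{..<n}"]
    by (simp add: mult.commute)
  finally show ?thesis .
qed

lemma sum_square_diff_le_load:
  fixes E :: "'v::finite \<Rightarrow> 'v \<Rightarrow> bool" and f :: "'v \<Rightarrow> real"
  assumes "connected_graph E"
  shows "(\<Sum>x\<in>UNIV. \<Sum>y\<in>UNIV. (f x - f y)\<^sup>2)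
    \<le> real (diam E) * (\<Sum>a\<in>UNIV. \<Sum>b\<in>UNIV. geodesic_load E a b * (f a - f b)\<^sup>2)"
  unfolding sum_geodesic_load[of E "\<lambda>a b. (f a - f b)\<^sup>2"] sum_distrib_left
proof (intro sum_mono)
  fix x y :: 'v
  let ?n = "graph_dist E x y"
  let ?W = "walks E ?n x y"
  have W: "?W \<noteq> {}" by (rule geodesics_nonempty[OF assms])
  \<comment> \<open>A constant is averaged over the geodesics, so that the telescoping bound applies
    to each of them.\<close>
  have "(f x - f y)\<^sup>2 = (\<Sum>xs\<in>?W. (f x - f y)\<^sup>2 / card ?W)" using W by simp
  also have "\<dots> \<le> (\<Sum>xs\<in>?W. real (diam E) * ((\<Sum>t<?n. (f (xs ! t) - f (xs ! Suc t))\<^sup>2) / card ?W))"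
  proof (intro sum_mono)
    fix xs assume xs: "xs \<in> ?W"
    have "(f x - f y)\<^sup>2 \<le> real ?n * (\<Sum>t<?n. (f (xs ! t) - f (xs ! Suc t))\<^sup>2)"
      using xs by (rule square_diff_along_walk)
    also have "\<dots> \<le> real (diam E) * (\<Sum>t<?n. (f (xs ! t) - f (xs ! Suc t))\<^sup>2)"
      by (intro mult_right_mono sum_nonneg) (auto simp: graph_dist_le_diam)
    finally show "(f x - f y)\<^sup>2 / card ?W
        \<le> real (diam E) * ((\<Sum>t<?n. (f (xs ! t) - f (xs ! Suc t))\<^sup>2) / card ?W)"
      by (simp add: divide_right_mono)
  qed
  finally show "(f x - f y)\<^sup>2
      \<le> (\<Sum>xs\<in>?W. real (diam E) * ((\<Sum>t<?n. (f (xs ! t) - f (xs ! Suc t))\<^sup>2) / card ?W))" .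
qed

section \<open>Edge classes and the pointwise bound on the load\<close>

lemma min_class_size_le:
  fixes E :: "'v::finite \<Rightarrow> 'v \<Rightarrow> bool"
  assumes "E a b"
  shows "min_class_size E k \<le> card {(c, d). k_equivalent E k [a, b] [c, d]}"
proof -
  let ?C = "{f. k_equivalent E k [a, b] f}"
  have "finite {e :: 'v list. length e = 2}" using finite_lists_length_eq[of "UNIV::'v set" 2] by simp
  then have "finite {e. graph_path E e \<and> length e = 2}" by (rule rev_finite_subset) auto
  then have "finite (edge_classes E k)" unfolding edge_classes_def quotient_def by simp
  moreover have "?C \<in> edge_classes E k"
  proof -
    have "[a, b] \<in> {e. graph_path E e \<and> length e = 2}" using assms by (simp add: graph_path_def)
    moreover have "?C = {(e, f). length e = 2 \<and> k_equivalent E k e f} `` {[a, b]}" by auto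
    ultimately show ?thesis unfolding edge_classes_def by (simp only: quotientI)
  qed
  ultimately have "min_class_size E k \<le> card ?C" unfolding min_class_size_def by (intro Min_le) auto
  \<comment> \<open>Classes consist of two-element lists, while the load takes two vertices.\<close>
  also have "?C = (\<lambda>(c, d). [c, d]) ` {(c, d). k_equivalent E k [a, b] [c, d]}"
  proof -
    have "\<exists>c d. f = [c, d]" if "k_equivalent E k [a, b] f" for f
    proof -
      have "length f = Suc (Suc 0)" using that by (simp add: k_equivalent_def)
      then show ?thesis by (auto simp: length_Suc_conv)
    qed
    then show ?thesis by force
  qed
  also have "card \<dots> = card {(c, d). k_equivalent E k [a, b] [c, d]}"
    by (intro card_image inj_onI) auto
  finally show ?thesis .
qed

text \<open>The load is constant on the class of the edge, so the size of that class times the load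
  is at most the total load.\<close>

lemma min_class_size_load_le:
  fixes E :: "'v::finite \<Rightarrow> 'v \<Rightarrow> bool"
  assumes "diam E \<le> 2 * k + 1" "E a b"
  shows "real (min_class_size E k) * geodesic_load E a b \<le> real (diam E) * (real CARD('v))\<^sup>2"
proof -
  let ?C = "{(c, d). k_equivalent E k [a, b] [c, d]}"
  have "real (min_class_size E k) * geodesic_load E a b \<le> real (card ?C) * geodesic_load E a b"
    using min_class_size_le[of E a b k, OF assms(2)] by (intro mult_right_mono geodesic_load_nonneg) simp
  also have "\<dots> = (\<Sum>q\<in>?C. geodesic_load E a b)" by simp
  also have "\<dots> = (\<Sum>(c, d)\<in>?C. geodesic_load E c d)"
    using geodesic_load_k_equivalent[OF _ assms(1)] by (intro sum.cong refl) auto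
  also have "\<dots> \<le> (\<Sum>(c, d)\<in>UNIV. geodesic_load E c d)"
    by (intro sum_mono2) (auto simp: geodesic_load_nonneg)
  also have "\<dots> = (\<Sum>c\<in>UNIV. \<Sum>d\<in>UNIV. geodesic_load E c d)"
    by (simp add: sum.cartesian_product)
  also have "\<dots> \<le> real (diam E) * (real CARD('v))\<^sup>2" by (rule sum_geodesic_load_le)
  finally show ?thesis .
qed

section \<open>Degree and diameter\<close>

lemma deg_vertex_transitive:
  assumes "vertex_transitive E" shows "deg E i = deg E j"
proof -
  obtain \<sigma> where \<sigma>: "bij \<sigma>" "\<And>x y. E (\<sigma> x) (\<sigma> y) = E x y" "\<sigma> i = j"
    using assms unfolding vertex_transitive_def graph_automorphism_def by blast
  have "{y. E j y} = \<sigma> ` {y. E i y}"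
    using \<sigma> by (auto simp: image_iff) (metis bij_pointE)
  then show ?thesis using \<sigma>(1) by (simp add: deg_def card_image[OF inj_on_subset[OF bij_is_inj]])
qed

lemma deg_pos:
  fixes E :: "'v::finite \<Rightarrow> 'v \<Rightarrow> bool" and x y :: 'v
  assumes "connected_graph E" "x \<noteq> y" shows "0 < deg E x"
proof -
  obtain n xs where "xs \<in> walks E n x y"
    using geodesics_nonempty[OF assms(1), of x y] by auto
  \<comment> \<open>The second vertex of the walk is a neighbour; the case rule separates lists with
    none, one and at least two entries.\<close>
  then have "\<exists>z. E x z"
    using assms(2) by (cases xs rule: remdups_adj.cases) (auto simp: walks_def graph_path_def)
  then show ?thesis by (auto simp: deg_def card_gt_0_iff)
qed

lemma diam_pos:
  fixes E :: "'v::finite \<Rightarrow> 'v \<Rightarrow> bool" and x y :: 'v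
  assumes "connected_graph E" "x \<noteq> y" shows "0 < diam E"
proof -
  have "walks E 0 x y = {}" using assms(2) by (auto simp: walks_def length_Suc_conv)
  then have "graph_dist E x y \<noteq> 0" using geodesics_nonempty[OF assms(1), of x y] by metis
  then show ?thesis using graph_dist_le_diam[of E x y] by simp
qed

section \<open>The spectral gap\<close>

locale regular_graph =
  fixes E :: "'v::finite \<Rightarrow> 'v \<Rightarrow> bool" and d :: nat
  assumes simple: "simple_graph E" and deg_eq: "\<And>i. deg E i = d" and d_pos: "0 < d"
begin

lemma adj_sym: "E i j = E j i"
  using simple by (auto simp: simple_graph_def symp_def)

lemma not_adj_refl: "\<not> E i i"
  using simple by (auto simp: simple_graph_def irreflp_def)

lemma volume_eq: "real (volume E) = real CARD('v) * real d"
  by (simp add: volume_def deg_eq)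

lemma sum_adj_const: "(\<Sum>j\<in>UNIV. of_bool (E i j) * c) = real d * c"
  using deg_eq[of i] by (simp add: deg_def sum_distrib_right[symmetric])

lemma normalized_Laplacian_entry:
  "normalized_Laplacian E $ i $ j = of_bool (i = j) - of_bool (E i j) / real d"
  using d_pos by (simp add: normalized_Laplacian_def deg_eq not_adj_refl)

lemma transpose_normalized_Laplacian: "transpose (normalized_Laplacian E) = normalized_Laplacian E"
  by (simp add: vec_eq_iff transpose_def normalized_Laplacian_entry adj_sym[of _ i for i] eq_commute)

lemma normalized_Laplacian_apply:
  "(normalized_Laplacian E *v x) $ i = x $ i - (\<Sum>j\<in>UNIV. of_bool (E i j) * x $ j) / real d"
proof -
  have "(normalized_Laplacian E *v x) $ i
      = (\<Sum>j\<in>UNIV. (if i = j then x $ j else 0) - of_bool (E i j) * x $ j / real d)"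
    unfolding matrix_vector_mult_def vec_lambda_beta normalized_Laplacian_entry
    by (intro sum.cong refl) (simp add: left_diff_distrib)
  then show ?thesis unfolding sum_subtractf sum_divide_distrib by simp
qed

text \<open>The diagonal entries are 1, so the Rayleigh quotient at a basis vector forces the
  largest eigenvalue to be at least 1. Thus the finite set under \<open>Min\<close> is
  nonempty.\<close>

lemma lambda1_is_eigenvalue:
  "real_eigenvalue (normalized_Laplacian E) (lambda1 E)" "lambda1 E \<noteq> 0"
proof -
  let ?L = "normalized_Laplacian E"
  let ?S = "{\<mu>. real_eigenvalue ?L \<mu> \<and> \<mu> \<noteq> 0}"
  obtain \<mu> where \<mu>: "real_eigenvalue ?L \<mu>" "\<And>x. x \<bullet> (?L *v x) \<le> \<mu> * (x \<bullet> x)"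
    using maximal_real_eigenvalue[OF transpose_normalized_Laplacian] by blast
  obtain i :: 'v where True by blast
  have "(?L *v axis i 1) $ i = 1"
    by (simp add: matrix_vector_mult_basis column_def normalized_Laplacian_entry not_adj_refl)
  then have "1 \<le> \<mu>" using \<mu>(2)[of "axis i 1"] by (simp add: inner_axis' inner_axis)
  then have "?S \<noteq> {}" using \<mu>(1) by force
  moreover have "finite ?S"
    using finite_real_eigenvalues[OF transpose_normalized_Laplacian] by (rule rev_finite_subset) auto
  ultimately have "lambda1 E \<in> ?S" unfolding lambda1_def by (intro Min_in)
  then show "real_eigenvalue ?L (lambda1 E)" "lambda1 E \<noteq> 0" by auto
qed

section \<open>Eigenfunctions on a regular graph\<close>

context
  fixes f :: "'v \<Rightarrow> real" and \<mu> :: real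
  assumes eigen: "\<And>i. (\<Sum>j\<in>UNIV. of_bool (E i j) * f j) = real d * (1 - \<mu>) * f i"
begin

text \<open>Summing \<open>eigen\<close> over all vertices counts each \<open>f j\<close> with
  multiplicity \<open>d\<close>, so the total is unchanged by the factor
  \<open>1 - \<mu>\<close>.\<close>

lemma eigenfunction_sum_zero:
  assumes "\<mu> \<noteq> 0" shows "(\<Sum>i\<in>UNIV. f i) = 0"
proof -
  have "real d * (1 - \<mu>) * (\<Sum>i\<in>UNIV. f i) = (\<Sum>i\<in>UNIV. \<Sum>j\<in>UNIV. of_bool (E i j) * f j)"
    by (simp only: eigen sum_distrib_left)
  also have "\<dots> = (\<Sum>j\<in>UNIV. \<Sum>i\<in>UNIV. of_bool (E j i) * f j)"
    by (subst sum.swap) (simp only: adj_sym)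
  also have "\<dots> = real d * (\<Sum>i\<in>UNIV. f i)"
    by (simp only: sum_adj_const sum_distrib_left)
  finally show ?thesis using assms d_pos by (simp add: algebra_simps)
qed

text \<open>Expanding the square gives two degree terms and a cross term evaluated by
  \<open>eigen\<close>. The factor 2 reflects the two orientations of each edge.\<close>

lemma eigenfunction_energy:
  "(\<Sum>i\<in>UNIV. \<Sum>j\<in>UNIV. of_bool (E i j) * (f i - f j)\<^sup>2) = 2 * real d * \<mu> * (\<Sum>i\<in>UNIV. (f i)\<^sup>2)"
proof -
  have "(\<Sum>i\<in>UNIV. \<Sum>j\<in>UNIV. of_bool (E i j) * (f i - f j)\<^sup>2)
      = (\<Sum>i\<in>UNIV. \<Sum>j\<in>UNIV. of_bool (E i j) * (f i)\<^sup>2) + (\<Sum>i\<in>UNIV. \<Sum>j\<in>UNIV. of_bool (E i j) * (f j)\<^sup>2)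
        - 2 * (\<Sum>i\<in>UNIV. f i * (\<Sum>j\<in>UNIV. of_bool (E i j) * f j))"
    unfolding sum_distrib_left sum.distrib[symmetric] sum_subtractf[symmetric]
    by (intro sum.cong refl) (simp add: power2_eq_square algebra_simps)
  also have "(\<Sum>i\<in>UNIV. \<Sum>j\<in>UNIV. of_bool (E i j) * (f i)\<^sup>2) = real d * (\<Sum>i\<in>UNIV. (f i)\<^sup>2)"
    by (simp only: sum_adj_const sum_distrib_left)
  also have "(\<Sum>i\<in>UNIV. \<Sum>j\<in>UNIV. of_bool (E i j) * (f j)\<^sup>2)
      = (\<Sum>j\<in>UNIV. \<Sum>i\<in>UNIV. of_bool (E j i) * (f j)\<^sup>2)"
    by (subst sum.swap) (simp only: adj_sym)
  also have "\<dots> = real d * (\<Sum>i\<in>UNIV. (f i)\<^sup>2)"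
    by (simp only: sum_adj_const sum_distrib_left)
  also have "(\<Sum>i\<in>UNIV. f i * (\<Sum>j\<in>UNIV. of_bool (E i j) * f j))
      = (\<Sum>i\<in>UNIV. f i * (real d * (1 - \<mu>) * f i))"
    by (simp only: eigen)
  also have "\<dots> = real d * (1 - \<mu>) * (\<Sum>i\<in>UNIV. (f i)\<^sup>2)"
    by (simp add: sum_distrib_left power2_eq_square mult_ac)
  finally show ?thesis by (simp add: algebra_simps)
qed

end

end

text \<open>The cross term is a multiple of the squared total of \<open>f\<close>, which is
  0.\<close>

lemma sum_square_diff:
  fixes f :: "'v::finite \<Rightarrow> real"
  assumes "(\<Sum>i\<in>UNIV. f i) = 0"
  shows "(\<Sum>x\<in>UNIV. \<Sum>y\<in>UNIV. (f x - f y)\<^sup>2) = 2 * real CARD('v) * (\<Sum>x\<in>UNIV. (f x)\<^sup>2)"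
proof -
  have "(\<Sum>x\<in>UNIV. \<Sum>y\<in>UNIV. (f x - f y)\<^sup>2)
      = (\<Sum>x\<in>UNIV. \<Sum>y\<in>(UNIV::'v set). (f x)\<^sup>2) + (\<Sum>x\<in>(UNIV::'v set). \<Sum>y\<in>UNIV. (f y)\<^sup>2)
        - 2 * (\<Sum>x\<in>UNIV. f x * (\<Sum>y\<in>UNIV. f y))"
    unfolding sum_distrib_left sum.distrib[symmetric] sum_subtractf[symmetric]
    by (intro sum.cong refl) (simp add: power2_eq_square algebra_simps)
  then show ?thesis using assms by (simp add: sum_distrib_left[symmetric])
qed

theorem theorem3p8:
  fixes E :: "'v::finite \<Rightarrow> 'v \<Rightarrow> bool" and k :: nat
  assumes "k \<ge> 1"
    and "simple_graph E"
    and "connected_graph E"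
    and "vertex_transitive E"
    and "CARD('v) \<ge> 2"
    and "diam E \<le> 2 * k + 1"
  shows "lambda1 E \<ge> 1 / ((real (diam E))\<^sup>2 * ind E k)"
proof -
  obtain u v :: 'v where "u \<noteq> v"
    using assms(5) card_le_Suc0_iff_eq[of "UNIV :: 'v set"] by fastforce
  interpret regular_graph E "deg E u"
    using assms(2) deg_vertex_transitive[OF assms(4)] deg_pos[OF assms(3) \<open>u \<noteq> v\<close>]
    by unfold_locales
  let ?d = "real (deg E u)" and ?n = "real CARD('v)" and ?D = "real (diam E)"
    and ?r = "real (min_class_size E k)" and ?\<mu> = "lambda1 E"
  obtain z where z: "z \<noteq> 0" "normalized_Laplacian E *v z = ?\<mu> *\<^sub>R z"
    using lambda1_is_eigenvalue(1) by (auto simp: real_eigenvalue_def)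
  define f where "f i = z $ i" for i
  define S where "S = (\<Sum>i\<in>UNIV. (f i)\<^sup>2)"
  have "f i - (\<Sum>j\<in>UNIV. of_bool (E i j) * f j) / ?d = ?\<mu> * f i" for i
    using arg_cong[OF z(2), of "\<lambda>w. w $ i"] by (simp add: normalized_Laplacian_apply f_def)
  then have eigen: "(\<Sum>j\<in>UNIV. of_bool (E i j) * f j) = ?d * (1 - ?\<mu>) * f i" for i
    using d_pos by (simp add: field_simps)
  have "S \<noteq> 0"
    using z(1) by (auto simp: S_def f_def sum_nonneg_eq_0_iff vec_eq_iff)
  then have S: "S > 0" unfolding S_def by (simp add: less_le sum_nonneg)
  have D: "?D > 0" using diam_pos[OF assms(3) \<open>u \<noteq> v\<close>] by simp
  have d: "?d > 0" using d_pos by simp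
  \<comment> \<open>A Poincare inequality with \<open>?r\<close> kept as a factor: the spread of
    \<open>f\<close> over all pairs is bounded by its load-weighted energy, then by its energy on
    edges.\<close>
  have "?r * (2 * ?n * S) \<le> ?r * (?D * (\<Sum>a\<in>UNIV. \<Sum>b\<in>UNIV. geodesic_load E a b * (f a - f b)\<^sup>2))"
    unfolding S_def sum_square_diff[OF eigenfunction_sum_zero[OF eigen lambda1_is_eigenvalue(2)], symmetric]
    by (intro mult_left_mono sum_square_diff_le_load assms(3)) simp
  also have "\<dots> = ?D * (\<Sum>a\<in>UNIV. \<Sum>b\<in>UNIV. ?r * geodesic_load E a b * (f a - f b)\<^sup>2)"
    by (simp add: sum_distrib_left mult_ac)
  also have "\<dots> \<le> ?D * (\<Sum>a\<in>UNIV. \<Sum>b\<in>UNIV. ?D * ?n\<^sup>2 * (of_bool (E a b) * (f a - f b)\<^sup>2))"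
  proof (intro mult_left_mono sum_mono)
    fix a b
    show "?r * geodesic_load E a b * (f a - f b)\<^sup>2 \<le> ?D * ?n\<^sup>2 * (of_bool (E a b) * (f a - f b)\<^sup>2)"
      using min_class_size_load_le[OF assms(6), of a b]
      by (cases "E a b") (simp_all add: geodesic_load_non_edge mult_right_mono)
  qed simp
  also have "\<dots> = ?D * (?D * ?n\<^sup>2 * (2 * ?d * ?\<mu> * S))"
    unfolding sum_distrib_left[symmetric] eigenfunction_energy[OF eigen] S_def ..
  \<comment> \<open>The positive factor \<open>2 * ?n * S\<close> is set apart for cancellation; the
    remaining \<open>?n * ?d\<close> is the volume.\<close>
  finally have "(2 * ?n * S) * ?r \<le> (2 * ?n * S) * (?D\<^sup>2 * (?n * ?d) * ?\<mu>)"
    by (simp add: power2_eq_square mult_ac)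
  then have "?r \<le> ?\<mu> * (?D\<^sup>2 * real (volume E))"
    using S by (simp add: volume_eq mult_ac)
  moreover have "0 < ?D\<^sup>2 * real (volume E)" using D d by (simp add: volume_eq)
  ultimately have "?r / (?D\<^sup>2 * real (volume E)) \<le> ?\<mu>" by (simp add: pos_divide_le_eq)
  \<comment> \<open>Inverting \<open>ind\<close> is valid for every value of \<open>?r\<close>,
    since division by 0 gives 0.\<close>
  then show ?thesis by (simp add: ind_def)
qed

end
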